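(* Let $p$ be an odd prime. Let $e$ be an even divisor of $p-1$ and let $p_1,\dots,p_s$ (with $s\geq 0$) be the distinct primes dividing $p-1$ that do not divide $e$. Set $\delta=1-\sum_{i=1}^s p_i^{-1}$ and suppose $\delta>0$. Let $r,h$ be positive integers and let $H>0$ be a real number. Suppose $h\geq 2$, $H\geq 2h$, and $2H^2<hp$. Set $X=H/h$. Let $W(p,h,r)$ be a real number such that for all non-principal Dirichlet characters $\chi$ modulo $p$ we have \[ \sum_{x\in\mathbb{F}_p} \left|\sum_{n=0}^{h-1} \chi(x+n)\right|^{2r}\leq W(p,h,r)\,p^{1/2}h^{2r}. \] If \[ \frac{\pi^2}{6}\,\frac{B(X)^{2r-1}}{A(X)^{2r}} \left(\left(2+\frac{s-1}{\delta}\right)2^{\omega-s}\right)^{2r}h\,p^{1/2}\,W(p,h,r)<H^2, \] where \[ A(X)=1-\frac{2\pi^2}{9X},\qquad B(X)=1+\frac{2\pi^2}{9X}+\frac{1}{h}+\frac{\pi^2}{3h}\frac{\log X}{X}, \] then $g(p)<H$.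
   Context: For an odd prime $p$, $g(p)$ denotes the least primitive root modulo $p$, i.e. the least positive integer that generates the multiplicative group $(\mathbb{Z}/p\mathbb{Z})^\times$. $\omega=\omega(p-1)$ denotes the number of distinct prime factors of $p-1$. Dirichlet characters modulo $p$ are regarded as functions on $\mathbb{F}_p=\mathbb{Z}/p\mathbb{Z}$ (with value $0$ at $0$). $\log$ is the natural logarithm. *)

theory Defs
  imports Complex_Main "HOL-Number_Theory.Number_Theory"
begin

definition least_primroot :: "nat \<Rightarrow> nat" where
  "least_primroot p = (LEAST g. 0 < g \<and> residue_primroot p g)"

text \<open>Functions on the ring of integers modulo \<open>m\<close> are represented by \<open>m\<close>-periodic functions on the integers.\<close>

definition dirichlet_character :: "nat \<Rightarrow> (int \<Rightarrow> complex) \<Rightarrow> bool" where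
  "dirichlet_character m chi \<longleftrightarrow>
     (\<forall>a. chi (a + int m) = chi a) \<and>
     (\<forall>a b. chi (a * b) = chi a * chi b) \<and>
     (\<forall>a. chi a \<noteq> 0 \<longleftrightarrow> coprime a (int m))"

definition principal_character :: "nat \<Rightarrow> int \<Rightarrow> complex" where
  "principal_character m a = (if coprime a (int m) then 1 else 0)"

end

theory Submission
  imports Defs "HOL-Analysis.Analysis" "HOL-Computational_Algebra.Squarefree"
begin

text \<open>Suppose no primitive root lies in \<open>(0, H)\<close>. Sieving with the primes \<open>p\<^sub>i\<close> writes a function
  that is \<open>\<le> 0\<close> at every non-root as a positive multiple of \<open>\<delta> + u\<close>, where \<open>u\<close> is a combination of
  non-principal characters of total weight at most \<open>\<delta> C\<close>,
  \<open>C = (2 + (s - 1) / \<delta>) 2\<^sup>\<omega>\<^sup>-\<^sup>s\<close>. Multiplying by \<open>q \<le> X\<close> moves the points near a fraction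
  \<open>p c / q\<close> into \<open>(0, H)\<close> or \<open>(-H, 0)\<close> modulo \<open>p\<close>; since absolute values of character sums do not
  see the factor \<open>\<plusminus>q\<close>, every \<open>x\<close> starting a block of \<open>h\<close> such points satisfies
  \<open>\<Sum>\<bar>c\<^sub>\<chi>\<bar> \<bar>S\<^sub>\<chi>(x)\<bar> \<ge> \<delta> h\<close>. These intervals are disjoint, so by Minkowski's inequality
  the number of such \<open>x\<close> is at most \<open>C\<^sup>2\<^sup>r W p\<^sup>1\<^sup>/\<^sup>2\<close>. On the other hand it is at least
  \<open>2 h \<Sum>\<^sub>q\<^sub>\<le>\<^sub>X \<phi>(q) (X / q - 1)\<close>, and Moebius inversion with \<open>\<bar>\<Sum>\<^sub>d\<^sub>\<le>\<^sub>N \<mu>(d) / d\<bar> \<le> 1\<close> shows that this sum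
  is at least \<open>3 X\<^sup>2 / \<pi>\<^sup>2 - 5 X / 8\<close>.\<close>

section \<open>A weighted sum of the totient function\<close>

definition moebius_mu :: "nat \<Rightarrow> real" where
  "moebius_mu n = (if squarefree n then (- 1) ^ card (prime_factors n) else 0)"

lemma abs_moebius_le_1: "\<bar>moebius_mu n\<bar> \<le> 1"
  by (simp add: moebius_mu_def power_abs)

lemma moebius_prime_mult:
  assumes "prime q" "d > 0"
  shows "moebius_mu (q * d) = (if q dvd d then 0 else - moebius_mu d)"
proof (cases "q dvd d")
  case True
  then have "q\<^sup>2 dvd q * d" by (simp add: power2_eq_square)
  then have "\<not> squarefree (q * d)"
    using assms by (auto simp: squarefree_def dest!: spec[of _ q])
  with True show ?thesis by (simp add: moebius_mu_def)
next
  case False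
  have "coprime q d" using False assms by (simp add: prime_imp_coprime)
  then have "squarefree (q * d) \<longleftrightarrow> squarefree d"
    using assms squarefree_mult_coprime[of q d] squarefree_multD(2)[of q d]
    by (auto simp: squarefree_prime)
  moreover have "prime_factors (q * d) = insert q (prime_factors d)"
    using assms by (simp add: prime_factors_product prime_prime_factors)
  moreover have "q \<notin> prime_factors d" using False by auto
  ultimately show ?thesis using False by (simp add: moebius_mu_def)
qed

text \<open>For a prime \<open>q\<close> dividing \<open>n\<close>, each divisor \<open>d\<close>
  not divisible by \<open>q\<close> cancels against \<open>q * d\<close>; the remaining divisors are
  divisible by \<open>q\<^sup>2\<close> and contribute 0.\<close>

lemma sum_moebius_divisors:
  assumes "n > 0"
  shows "(\<Sum>d | d dvd n. moebius_mu d) = (if n = 1 then 1 else 0)"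
proof (cases "n = 1")
  case True
  then show ?thesis by (simp add: moebius_mu_def)
next
  case False
  then obtain q where q: "prime q" "q dvd n"
    using prime_factor_nat by blast
  have fin: "finite {d. d dvd n}" using assms by simp
  define S where "S = {d. d dvd n \<and> \<not> q dvd d}"
  have pos: "d > 0" if "d dvd n" for d using that assms by (auto intro!: Nat.gr0I)
  have inj: "inj_on ((*) q) S" using q by (auto simp: inj_on_def prime_gt_0_nat)
  have dvd: "q * d dvd n" if "d \<in> S" for d
    using that q by (intro divides_mult) (auto simp: S_def prime_imp_coprime)
  have zero: "moebius_mu d = 0" if "d dvd n" "q dvd d" "d \<notin> (*) q ` S" for d
  proof -
    from that obtain d' where d': "d = q * d'" by auto
    then have "d' \<notin> S" "d' dvd n" using that by (auto simp: dvd_mult_right)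
    then show ?thesis using moebius_prime_mult[of q d'] q d' pos[of d'] by (simp add: S_def)
  qed
  have "(\<Sum>d | d dvd n. moebius_mu d) = (\<Sum>d\<in>S. moebius_mu d) + (\<Sum>d | d dvd n \<and> q dvd d. moebius_mu d)"
    unfolding S_def by (subst sum.union_disjoint[symmetric])
      (use fin in \<open>auto intro!: sum.cong\<close>)
  also have "(\<Sum>d | d dvd n \<and> q dvd d. moebius_mu d) = (\<Sum>d\<in>(*) q ` S. moebius_mu d)"
    by (rule sum.mono_neutral_right) (use fin dvd zero in auto)
  also have "\<dots> = (\<Sum>d\<in>S. moebius_mu (q * d))"
    by (simp add: sum.reindex[OF inj])
  also have "\<dots> = (\<Sum>d\<in>S. - moebius_mu d)"
    by (rule sum.cong) (use q pos in \<open>auto simp: moebius_prime_mult S_def\<close>)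
  finally show ?thesis using False by (simp add: sum_negf)
qed

text \<open>Both sides run over the factorisations \<open>n = d * k\<close> with
  \<open>n \<le> N\<close>, grouped by \<open>n\<close> or by \<open>d\<close>.\<close>

lemma sum_divisor_pairs:
  fixes f :: "nat \<Rightarrow> nat \<Rightarrow> 'a :: comm_monoid_add"
  shows "(\<Sum>n\<in>{1..N}. \<Sum>d | d dvd n. f d (n div d)) = (\<Sum>d\<in>{1..N}. \<Sum>k\<in>{1..N div d}. f d k)"
proof -
  have "(\<Sum>n\<in>{1..N}. \<Sum>d | d dvd n. f d (n div d)) =
        (\<Sum>(n,d)\<in>(SIGMA n:{1..N}. {d. d dvd n}). f d (n div d))"
    by (subst sum.Sigma) auto
  also have "\<dots> = (\<Sum>(d,k)\<in>(SIGMA d:{1..N}. {1..N div d}). f d k)"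
  proof (rule sum.reindex_bij_witness[of _ "\<lambda>(d,k). (d * k, d)" "\<lambda>(n,d). (d, n div d)"], goal_cases)
    case (2 x)
    then obtain d k where x: "x = (d * k, d)" "0 < d" "0 < k" "d * k \<le> N"
      by (auto elim!: dvdE)
    then have "d \<le> d * k" by simp
    then have "d \<le> N" using x by linarith
    with x show ?case by (auto simp: less_eq_div_iff_mult_less_eq mult.commute Suc_le_eq)
  next
    case (4 x)
    then show ?case 
      by (auto simp: less_eq_div_iff_mult_less_eq mult.commute)
  qed (auto simp: Suc_le_eq)
  also have "\<dots> = (\<Sum>d\<in>{1..N}. \<Sum>k\<in>{1..N div d}. f d k)"
    by (subst sum.Sigma) auto
  finally show ?thesis .
qed

text \<open>Moebius inversion: \<open>n div d\<close> is expanded into totients of its divisors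
  \<open>c\<close>; after exchanging the sums, \<open>sum_moebius_divisors\<close> leaves only
  \<open>c = n\<close>.\<close>

lemma totient_moebius:
  assumes "n > 0"
  shows "real (totient n) = (\<Sum>d | d dvd n. moebius_mu d * real (n div d))"
proof -
  have "(\<Sum>d | d dvd n. moebius_mu d * real (n div d)) =
        (\<Sum>d | d dvd n. \<Sum>c | c dvd n div d. moebius_mu d * real (totient c))"
    by (rule sum.cong) (simp_all flip: sum_distrib_left of_nat_sum add: totient_divisor_sum)
  also have "\<dots> = (\<Sum>(d,c)\<in>(SIGMA d:{d. d dvd n}. {c. c dvd n div d}). moebius_mu d * real (totient c))"
    by (rule sum.Sigma) (use assms in \<open>auto simp: dvd_div_eq_0_iff\<close>)
  also have "\<dots> = (\<Sum>(c,d)\<in>(SIGMA c:{c. c dvd n}. {d. d dvd n div c}). moebius_mu d * real (totient c))"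
    by (rule sum.reindex_bij_witness[of _ prod.swap prod.swap])
       (use assms in \<open>auto elim!: dvdE simp: mult.commute\<close>)
  also have "\<dots> = (\<Sum>c | c dvd n. \<Sum>d | d dvd n div c. moebius_mu d * real (totient c))"
    by (rule sum.Sigma[symmetric]) (use assms in \<open>auto simp: dvd_div_eq_0_iff\<close>)
  also have "\<dots> = (\<Sum>c | c dvd n. if c = n then real (totient c) else 0)"
  proof (rule sum.cong)
    fix c assume "c \<in> {c. c dvd n}"
    then have "n div c > 0" "n div c = 1 \<longleftrightarrow> c = n"
      using assms by (auto elim!: dvdE)
    then show "(\<Sum>d | d dvd n div c. moebius_mu d * real (totient c)) =
        (if c = n then real (totient c) else 0)"
      by (simp add: sum_moebius_divisors flip: sum_distrib_right)
  qed auto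
  also have "\<dots> = real (totient n)" using assms by simp
  finally show ?thesis by simp
qed

section \<open>Partial sums of mu(d) / d and mu(d) / d^2\<close>

lemma sum_moebius_floor:
  assumes "N > 0"
  shows "(\<Sum>d\<in>{1..N}. moebius_mu d * real (N div d)) = 1"
proof -
  have "(\<Sum>d\<in>{1..N}. moebius_mu d * real (N div d)) = (\<Sum>d\<in>{1..N}. \<Sum>k\<in>{1..N div d}. moebius_mu d)"
    by (simp add: mult.commute)
  also have "\<dots> = (\<Sum>n\<in>{1..N}. \<Sum>d | d dvd n. moebius_mu d)"
    by (rule sum_divisor_pairs[symmetric])
  also have "\<dots> = (\<Sum>n\<in>{1..N}. if n = 1 then 1 else 0)"
    by (rule sum.cong) (auto simp: sum_moebius_divisors simp del: One_nat_def)
  also have "\<dots> = 1" using assms by simp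
  finally show ?thesis .
qed

text \<open>Multiply by \<open>N\<close> and split \<open>N / d\<close> into \<open>N div d\<close>
  and a fractional part. The integer parts contribute 1 by \<open>sum_moebius_floor\<close>, the
  fractional parts at most \<open>N - 1\<close> in absolute value.\<close>

lemma abs_sum_moebius_over_id_le_1: "\<bar>\<Sum>d\<in>{1..N}. moebius_mu d / real d\<bar> \<le> 1"
proof (cases "N > 0")
  case True
  have *: "real N / real d = real (N div d) + real (N mod d) / real d" if "d > 0" for d
  proof -
    have "real N = real (N div d * d + N mod d)" by (simp only: div_mult_mod_eq)
    then have "real N = real (N div d) * real d + real (N mod d)"
      by (simp only: of_nat_mult of_nat_add)
    then show ?thesis using that by (simp add: add_divide_distrib)
  qed
  have "real N * (\<Sum>d\<in>{1..N}. moebius_mu d / real d) =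
     (\<Sum>d\<in>{1..N}. moebius_mu d * real (N div d)) + (\<Sum>d\<in>{1..N}. moebius_mu d * (real (N mod d) / real d))"
    unfolding sum_distrib_left sum.distrib[symmetric]
  proof (rule sum.cong)
    fix d assume "d \<in> {1..N}"
    then show "real N * (moebius_mu d / real d) =
        moebius_mu d * real (N div d) + moebius_mu d * (real (N mod d) / real d)"
      using arg_cong[OF *[of d], of "(*) (moebius_mu d)"] by (simp add: distrib_left mult.commute)
  qed auto
  \<comment> \<open>The term \<open>d = 1\<close> is 0. Only \<open>N - 1\<close> error terms
    remain, so that with the main term 1 the bound is exactly \<open>N\<close>.\<close>
  also have "(\<Sum>d\<in>{1..N}. moebius_mu d * (real (N mod d) / real d)) =
      (\<Sum>d\<in>{2..N}. moebius_mu d * (real (N mod d) / real d))"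
  proof (rule sum.mono_neutral_right)
    have "{1..N} - {2..N} \<subseteq> {1}" by auto
    then show "\<forall>d\<in>{1..N} - {2..N}. moebius_mu d * (real (N mod d) / real d) = 0" by auto
  qed auto
  also have "(\<Sum>d\<in>{1..N}. moebius_mu d * real (N div d)) = 1"
    by (rule sum_moebius_floor[OF True])
  finally have eq: "real N * (\<Sum>d\<in>{1..N}. moebius_mu d / real d) =
      1 + (\<Sum>d\<in>{2..N}. moebius_mu d * (real (N mod d) / real d))" .
  have "\<bar>\<Sum>d\<in>{2..N}. moebius_mu d * (real (N mod d) / real d)\<bar> \<le> (\<Sum>d\<in>{2..N}. 1)"
  proof (rule sum_abs[THEN order_trans], rule sum_mono)
    fix d assume "d \<in> {2..N}"
    then have "\<bar>real (N mod d) / real d\<bar> \<le> 1" by (simp add: less_imp_le)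
    then show "\<bar>moebius_mu d * (real (N mod d) / real d)\<bar> \<le> 1"
      using abs_moebius_le_1[of d] unfolding abs_mult by (rule mult_le_one[rotated 2]) auto
  qed
  then have "\<bar>real N * (\<Sum>d\<in>{1..N}. moebius_mu d / real d)\<bar> \<le> real N"
    unfolding eq using True by (simp add: of_nat_diff)
  then show ?thesis using True by (simp add: abs_mult)
qed auto

text \<open>Abel summation as an induction on \<open>M\<close>: the differences
  \<open>1 / k - 1 / (k + 1)\<close> are nonnegative, so each partial sum \<open>m k\<close> beyond
  \<open>N\<close> may be replaced by its upper bound 1.\<close>

lemma sum_moebius_over_square_tail:
  fixes m :: "nat \<Rightarrow> real"
  defines "m \<equiv> \<lambda>N. \<Sum>d\<in>{1..N}. moebius_mu d / real d"
  assumes "N \<le> M"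
  shows "(\<Sum>d\<in>{1..M}. moebius_mu d / (real d)\<^sup>2) \<le>
         (\<Sum>d\<in>{1..N}. moebius_mu d / (real d)\<^sup>2) + (m M - m N) / real (M + 1) 
         + (1 - m N) * (1 / real (N + 1) - 1 / real (M + 1))"
  using assms(2)
proof (induction M rule: dec_induct)
  case base
  then show ?case by simp
next
  case (step M)
  have mu: "moebius_mu (Suc M) / real (Suc M) = m (Suc M) - m M"
    by (simp add: m_def)
  have "moebius_mu (Suc M) / (real (Suc M))\<^sup>2 = (m (Suc M) - m M) / real (Suc M)"
    unfolding mu[symmetric] by (simp add: power2_eq_square)
  then have "(\<Sum>d\<in>{1..Suc M}. moebius_mu d / (real d)\<^sup>2) =
      (\<Sum>d\<in>{1..M}. moebius_mu d / (real d)\<^sup>2) + (m (Suc M) - m M) / real (Suc M)"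
    by simp
  also have "\<dots> \<le> (\<Sum>d\<in>{1..N}. moebius_mu d / (real d)\<^sup>2) + (m (Suc M) - m N) / real (M + 1)
         + (1 - m N) * (1 / real (N + 1) - 1 / real (M + 1))"
    using step.IH by (simp add: diff_divide_distrib)
  also have "\<dots> \<le> (\<Sum>d\<in>{1..N}. moebius_mu d / (real d)\<^sup>2) + (m (Suc M) - m N) / real (Suc M + 1)
         + (1 - m N) * (1 / real (N + 1) - 1 / real (Suc M + 1))"
  proof -
    have "m (Suc M) \<le> 1"
      using abs_sum_moebius_over_id_le_1[of "Suc M"] unfolding m_def by linarith
    moreover have "1 / real (M + 1) - 1 / real (Suc M + 1) \<ge> 0" by (simp add: field_simps)
    ultimately have "m (Suc M) * (1 / real (M + 1) - 1 / real (Suc M + 1)) 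
        \<le> 1 * (1 / real (M + 1) - 1 / real (Suc M + 1))"
      by (rule mult_right_mono)
    then show ?thesis by (simp add: algebra_simps diff_divide_distrib)
  qed
  finally show ?case .
qed


text \<open>The product with \<open>pi\<^sup>2 / 6\<close>, the sum of the inverse squares, is an
  absolutely convergent double series. Collecting the terms with \<open>d * k = n\<close> leaves
  only \<open>n = 1\<close>, so the product is 1.\<close>

lemma sum_moebius_over_square_limit:
  "(\<lambda>N. \<Sum>d\<in>{1..N}. moebius_mu d / (real d)\<^sup>2) \<longlonglongrightarrow> 6 / pi\<^sup>2"
proof -
  have "((\<lambda>n. 1 / (real n + 1)\<^sup>2) has_sum (pi\<^sup>2 / 6)) UNIV"
    using sums_nonneg_imp_has_sum[OF inverse_squares_sums] by (simp add: add.commute)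
  moreover have "bij_betw Suc UNIV {1..}" by (auto simp: bij_betw_def image_iff Suc_le_eq gr0_conv_Suc)
  ultimately have zeta: "((\<lambda>n. 1 / (real n)\<^sup>2) has_sum (pi\<^sup>2 / 6)) {1..}"
    by (subst has_sum_reindex_bij_betw[symmetric, of Suc UNIV]) (simp_all add: add.commute)
  have abs: "(\<lambda>d. norm (moebius_mu d / (real d)\<^sup>2)) summable_on {1..}"
  proof (rule summable_on_comparison_test)
    show "(\<lambda>n. 1 / (real n)\<^sup>2) summable_on {1..}" using zeta by (rule has_sum_imp_summable)
  qed (auto simp: abs_mult abs_moebius_le_1 intro!: divide_right_mono)
  define c where "c = infsum (\<lambda>d. moebius_mu d / (real d)\<^sup>2) {1..}"
  have c: "((\<lambda>d. moebius_mu d / (real d)\<^sup>2) has_sum c) {1..}"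
    unfolding c_def by (rule has_sum_infsum, rule abs_summable_summable[OF abs])
  define f where "f = (\<lambda>(d, k). moebius_mu d / (real d)\<^sup>2 * (1 / (real k)\<^sup>2))"
  have f1: "((\<lambda>k. f (d, k)) has_sum (moebius_mu d / (real d)\<^sup>2 * (pi\<^sup>2 / 6))) {1..}" for d
    unfolding f_def prod.case by (rule has_sum_cmult_right[OF zeta])
  have f2: "((\<lambda>k. norm (f (d, k))) has_sum (norm (moebius_mu d / (real d)\<^sup>2) * (pi\<^sup>2 / 6))) {1..}" for d
    using has_sum_cmult_right[OF zeta, of "norm (moebius_mu d / (real d)\<^sup>2)"]
    by (simp add: f_def abs_mult)
  have "(\<lambda>x. norm (f x)) summable_on {1..} \<times> {1..}"
    unfolding Infinite_Sum.abs_summable_on_Sigma_iff infsumI[OF f2]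
    using f2[THEN has_sum_imp_summable] summable_on_cmult_left[OF abs, of "pi\<^sup>2 / 6"]
    by (simp add: abs_mult)
  then have "(f has_sum (c * (pi\<^sup>2 / 6))) ({1..} \<times> {1..})"
    by (rule has_sum_SigmaI[OF f1 has_sum_cmult_left[OF c] abs_summable_summable])
  also have "?this \<longleftrightarrow> ((\<lambda>(n, d). moebius_mu d / (real n)\<^sup>2) has_sum (c * (pi\<^sup>2 / 6))) (SIGMA n:{1..}. {d. d dvd n})"
    by (rule has_sum_reindex_bij_witness[of _ "\<lambda>(n,d). (d, n div d)" "\<lambda>(d,k). (d * k, d)"])
       (auto simp: f_def power_mult_distrib Suc_le_eq intro!: Nat.gr0I)
  finally have "((\<lambda>n. \<Sum>d | d dvd n. moebius_mu d / (real n)\<^sup>2) has_sum (c * (pi\<^sup>2 / 6))) {1..}"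
    by (rule has_sum_SigmaD) (auto simp: Suc_le_eq intro!: has_sum_finiteI)
  also have "?this \<longleftrightarrow> ((\<lambda>n. if n = 1 then 1 else 0) has_sum (c * (pi\<^sup>2 / 6))) {1::nat..}"
    by (rule has_sum_cong) (auto simp: sum_moebius_divisors simp flip: sum_divide_distrib)
  finally have "((\<lambda>n. if n = 1 then 1 else 0) has_sum (c * (pi\<^sup>2 / 6))) {1::nat..}" .
  moreover have "((\<lambda>n. if n = 1 then 1 else 0) has_sum (1::real)) {1::nat..}"
    by (rule has_sum_finite_neutralI[of "{1}"]) auto
  ultimately have "c * (pi\<^sup>2 / 6) = 1" by (rule has_sum_unique)
  then have c_eq: "c = 6 / pi\<^sup>2" by (simp add: field_simps)
  \<comment> \<open>Including the index 0 changes nothing, since a quotient by 0 is 0.\<close>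
  have "((\<lambda>d. moebius_mu d / (real d)\<^sup>2) has_sum c) UNIV"
    using c by (rule has_sum_cong_neutral[THEN iffD1, rotated -1]) (auto simp: not_le)
  then have "(\<lambda>N. \<Sum>d<N. moebius_mu d / (real d)\<^sup>2) \<longlonglongrightarrow> c"
    using has_sum_imp_sums sums_def by blast
  then have "(\<lambda>N. \<Sum>d<Suc N. moebius_mu d / (real d)\<^sup>2) \<longlonglongrightarrow> c"
    by (rule LIMSEQ_Suc)
  also have "(\<lambda>N. \<Sum>d<Suc N. moebius_mu d / (real d)\<^sup>2) = (\<lambda>N. \<Sum>d\<in>{1..N}. moebius_mu d / (real d)\<^sup>2)"
    by (intro ext sum.mono_neutral_right) (auto simp: Suc_le_eq)
  finally show ?thesis by (simp add: c_eq)
qed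

text \<open>Let \<open>M\<close> tend to infinity in the tail estimate, where the terms in
  \<open>M\<close> combine to \<open>- (1 - m M) / (M + 1) \<le> 0\<close>. The sum of
  \<open>mu(d) / d\<close> stays explicit because it cancels in the totient estimate.\<close>

lemma sum_moebius_over_square_ge:
  "(\<Sum>d\<in>{1..N}. moebius_mu d / (real d)\<^sup>2) \<ge>
     6 / pi\<^sup>2 - (1 - (\<Sum>d\<in>{1..N}. moebius_mu d / real d)) / real (N + 1)"
proof -
  define m where "m = (\<lambda>N. \<Sum>d\<in>{1..N}. moebius_mu d / real d)"
  define S where "S = (\<lambda>N. \<Sum>d\<in>{1..N}. moebius_mu d / (real d)\<^sup>2)"
  have "S M \<le> S N + (1 - m N) / real (N + 1)" if "N \<le> M" for M
  proof -
    have "S M \<le> S N + (m M - m N) / real (M + 1) + (1 - m N) * (1 / real (N + 1) - 1 / real (M + 1))"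
      using sum_moebius_over_square_tail[OF that] by (simp add: S_def m_def)
    also have "\<dots> = S N + (1 - m N) / real (N + 1) - (1 - m M) / real (M + 1)"
      by (simp add: algebra_simps diff_divide_distrib)
    also have "\<dots> \<le> S N + (1 - m N) / real (N + 1)"
      using abs_sum_moebius_over_id_le_1[of M] by (simp add: m_def abs_le_iff)
    finally show ?thesis .
  qed
  then have "6 / pi\<^sup>2 \<le> S N + (1 - m N) / real (N + 1)"
    using sum_moebius_over_square_limit unfolding S_def by (intro LIMSEQ_le_const2) auto
  then show ?thesis by (simp add: S_def m_def)
qed

section \<open>Lower bound for the totient sum\<close>

lemma sum_floor_complement:
  fixes Y :: real
  assumes "real K \<le> Y" "Y < real K + 1"
  shows "\<bar>(\<Sum>k\<in>{1..K}. Y - real k) - (Y\<^sup>2 - Y) / 2\<bar> \<le> 1 / 8"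
proof -
  have "(\<Sum>k\<in>{1..K}. real k) = real K * (real K + 1) / 2"
    by (induction K) (auto simp: field_simps)
  then have eq: "(\<Sum>k\<in>{1..K}. Y - real k) = real K * Y - real K * (real K + 1) / 2"
    by (simp add: sum_subtractf)
  \<comment> \<open>\<open>f\<close> is the fractional part of \<open>Y\<close>; the error is
    \<open>f * (1 - f) / 2\<close>, which lies between 0 and \<open>1 / 8\<close>.\<close>
  define f where "f = Y - real K"
  have "(\<Sum>k\<in>{1..K}. Y - real k) - (Y\<^sup>2 - Y) / 2 = f * (1 - f) / 2"
    unfolding eq f_def by (simp add: field_simps power2_eq_square)
  moreover have "0 \<le> f * (1 - f)" using assms by (simp add: f_def)
  moreover have "f * (1 - f) \<le> 1 / 4"
    using zero_le_power2[of "f - 1 / 2"] by (simp add: power2_eq_square field_simps)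
  ultimately show ?thesis by linarith
qed

text \<open>Moebius inversion, grouped by \<open>d\<close>, produces inner sums of
  \<open>X / d - k\<close>, each a quadratic polynomial in \<open>X / d\<close> up to
  \<open>1 / 8\<close>. The quadratic part gives the main term through the sum of
  \<open>mu(d) / d\<^sup>2\<close>.\<close>

lemma sum_totient_weighted_ge:
  fixes X :: real
  assumes "X \<ge> 1"
  shows "(\<Sum>q\<in>{1..nat \<lfloor>X\<rfloor>}. real (totient q) * (X / real q - 1)) \<ge> 3 / pi\<^sup>2 * X\<^sup>2 - 5 / 8 * X"
proof -
  define N where "N = nat \<lfloor>X\<rfloor>"
  have N: "real N \<le> X" "X < real N + 1" using assms by (auto simp: N_def)
  define m where "m = (\<Sum>d\<in>{1..N}. moebius_mu d / real d)"
  define S where "S = (\<Sum>d\<in>{1..N}. moebius_mu d / (real d)\<^sup>2)"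
  have m1: "m \<le> 1" using abs_sum_moebius_over_id_le_1[of N] by (simp add: m_def abs_le_iff)
  have summand: "moebius_mu d * (\<Sum>k\<in>{1..N div d}. X / real d - real k) \<ge>
     X\<^sup>2 / 2 * (moebius_mu d / (real d)\<^sup>2) - X / 2 * (moebius_mu d / real d) - 1 / 8"
    if "d \<in> {1..N}" for d
  proof -
    have d: "d > 0" using that by simp
    have "N div d * d \<le> N" "N + 1 \<le> (N div d + 1) * d"
      using dividend_less_div_times[of d N] d by simp_all
    then have "real (N div d) * real d \<le> real N" "real N + 1 \<le> (real (N div d) + 1) * real d"
      by (metis of_nat_le_iff of_nat_mult, metis of_nat_le_iff of_nat_mult of_nat_add of_nat_1)
    then have "real (N div d) \<le> X / real d" "X / real d < real (N div d) + 1"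
      using N d by (auto simp: field_simps)
    from sum_floor_complement[OF this]
    have le: "\<bar>(\<Sum>k\<in>{1..N div d}. X / real d - real k) - ((X / real d)\<^sup>2 - X / real d) / 2\<bar> \<le> 1 / 8" .
    have "\<bar>moebius_mu d * ((\<Sum>k\<in>{1..N div d}. X / real d - real k) - ((X / real d)\<^sup>2 - X / real d) / 2)\<bar> \<le> 1 * (1 / 8)"
      unfolding abs_mult by (rule mult_mono[OF abs_moebius_le_1 le]) auto
    then have "moebius_mu d * (((X / real d)\<^sup>2 - X / real d) / 2) - 1 / 8 \<le>
        moebius_mu d * (\<Sum>k\<in>{1..N div d}. X / real d - real k)"
      unfolding abs_le_iff right_diff_distrib by linarith
    then show ?thesis by (simp add: right_diff_distrib power_divide diff_divide_distrib mult.commute)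
  qed
  have "(\<Sum>q\<in>{1..N}. real (totient q) * (X / real q - 1)) =
      (\<Sum>q\<in>{1..N}. \<Sum>d | d dvd q. moebius_mu d * (X / real d - real (q div d)))"
  proof (rule sum.cong)
    fix q assume q: "q \<in> {1..N}"
    show "real (totient q) * (X / real q - 1) = (\<Sum>d | d dvd q. moebius_mu d * (X / real d - real (q div d)))"
    proof -
      have "real (totient q) * (X / real q - 1) =
          (\<Sum>d | d dvd q. moebius_mu d * real (q div d) * (X / real q - 1))"
        using q by (simp add: totient_moebius sum_distrib_right)
      also have "\<dots> = (\<Sum>d | d dvd q. moebius_mu d * (X / real d - real (q div d)))"
      proof (rule sum.cong)
        fix d assume "d \<in> {d. d dvd q}"
        then obtain k where k: "q = d * k" by auto
        then have "d > 0" "k > 0" using q by (auto intro: Nat.gr0I)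
        then have "real (q div d) * (X / real q - 1) = X / real d - real (q div d)"
          by (simp add: k right_diff_distrib)
        then show "moebius_mu d * real (q div d) * (X / real q - 1) =
            moebius_mu d * (X / real d - real (q div d))"
          by (simp only: mult.assoc)
      qed auto
      finally show ?thesis .
    qed
  qed auto
  also have "\<dots> = (\<Sum>d\<in>{1..N}. \<Sum>k\<in>{1..N div d}. moebius_mu d * (X / real d - real k))"
    by (rule sum_divisor_pairs)
  also have "\<dots> = (\<Sum>d\<in>{1..N}. moebius_mu d * (\<Sum>k\<in>{1..N div d}. X / real d - real k))"
    by (simp only: sum_distrib_left)
  also have "\<dots> \<ge> (\<Sum>d\<in>{1..N}. X\<^sup>2 / 2 * (moebius_mu d / (real d)\<^sup>2) - X / 2 * (moebius_mu d / real d) - 1 / 8)"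
    by (rule sum_mono) (rule summand)
  also have "(\<Sum>d\<in>{1..N}. X\<^sup>2 / 2 * (moebius_mu d / (real d)\<^sup>2) - X / 2 * (moebius_mu d / real d) - 1 / 8) =
     X\<^sup>2 / 2 * S - X / 2 * m - real N / 8"
    unfolding S_def m_def sum_subtractf sum_distrib_left[symmetric] by simp
  finally have 1: "X\<^sup>2 / 2 * S - X / 2 * m - real N / 8 \<le>
      (\<Sum>q\<in>{1..N}. real (totient q) * (X / real q - 1))" .
  \<comment> \<open>With \<open>X < N + 1\<close> the tail error costs
    \<open>X / 2 * (1 - m)\<close>, whose part in \<open>m\<close> cancels the linear term
    \<open>X / 2 * m\<close> exactly.\<close>
  have "(1 - m) / real (N + 1) \<le> (1 - m) / X"
    using m1 N assms by (intro divide_left_mono) auto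
  then have "S \<ge> 6 / pi\<^sup>2 - (1 - m) / X"
    using sum_moebius_over_square_ge[of N] by (simp add: S_def m_def)
  then have "X\<^sup>2 / 2 * S \<ge> X\<^sup>2 / 2 * (6 / pi\<^sup>2 - (1 - m) / X)"
    by (rule mult_left_mono) auto
  also have "X\<^sup>2 / 2 * (6 / pi\<^sup>2 - (1 - m) / X) = 3 / pi\<^sup>2 * X\<^sup>2 - X / 2 * (1 - m)"
    using assms by (simp add: field_simps power2_eq_square)
  also have "X / 2 * (1 - m) = X / 2 - X / 2 * m" by (simp add: right_diff_distrib)
  \<comment> \<open>\<open>5 / 8\<close> is \<open>1 / 2\<close> from the tail plus
    \<open>1 / 8\<close> from the \<open>N \<le> X\<close> rounding errors.\<close>
  finally show ?thesis using 1 N unfolding N_def[symmetric] by linarith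
qed

section \<open>Character expansion of the sieve\<close>

lemma eq_1_if_coprime_powers_eq_1:
  fixes z :: "'a :: comm_monoid_mult"
  assumes "z ^ m = 1" "z ^ n = 1" "coprime m n" "m > 0"
  shows "z = 1"
proof -
  obtain x y where "m * x = n * y + gcd m n" using bezout_nat[of m n] \<open>m > 0\<close> by auto
  then have "m * x = n * y + 1" using \<open>coprime m n\<close> by simp
  then have "(z ^ m) ^ x = (z ^ n) ^ y * z"
    by (metis power_add power_mult power_one_right)
  then show ?thesis using assms by simp
qed

lemma dirichlet_character_mult:
  "dirichlet_character p chi \<Longrightarrow> dirichlet_character p \<psi> \<Longrightarrow> dirichlet_character p (\<lambda>a. chi a * \<psi> a)"
  unfolding dirichlet_character_def by auto

lemma dirichlet_character_power:
  "dirichlet_character p chi \<Longrightarrow> k > 0 \<Longrightarrow> dirichlet_character p (\<lambda>a. chi a ^ k)"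
  unfolding dirichlet_character_def by (auto simp: power_mult_distrib)

definition nonprincipal_of_order_dvd :: "nat \<Rightarrow> nat \<Rightarrow> (int \<Rightarrow> complex) \<Rightarrow> bool" where
  "nonprincipal_of_order_dvd p Q chi \<longleftrightarrow> dirichlet_character p chi \<and> chi \<noteq> principal_character p \<and>
     (\<forall>a. coprime a (int p) \<longrightarrow> chi a ^ Q = 1)"

lemma nonprincipal_iff:
  assumes "dirichlet_character p chi"
  shows "chi \<noteq> principal_character p \<longleftrightarrow> (\<exists>a. coprime a (int p) \<and> chi a \<noteq> 1)"
proof -
  have "chi a = 0" if "\<not> coprime a (int p)" for a
    using assms that by (auto simp: dirichlet_character_def)
  then have "chi = principal_character p" if "\<And>a. coprime a (int p) \<Longrightarrow> chi a = 1"
    using that by (auto simp: principal_character_def fun_eq_iff)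
  then show ?thesis by (auto simp: principal_character_def)
qed

text \<open>Where \<open>chi a \<noteq> 1\<close>, a product equal to 1 would, raised to the power
  \<open>Q'\<close>, give \<open>chi a ^ Q' = 1\<close>; together with \<open>chi a ^ Q = 1\<close>
  and coprimality this forces \<open>chi a = 1\<close>.\<close>

lemma nonprincipal_of_order_dvd_mult:
  assumes chi: "nonprincipal_of_order_dvd p Q chi" and \<psi>: "nonprincipal_of_order_dvd p Q' \<psi>"
    and "coprime Q Q'" "Q > 0"
  shows "nonprincipal_of_order_dvd p (Q * Q') (\<lambda>a. chi a * \<psi> a)"
proof -
  have char: "dirichlet_character p (\<lambda>a. chi a * \<psi> a)"
    using chi \<psi> by (intro dirichlet_character_mult) (auto simp: nonprincipal_of_order_dvd_def)
  obtain a where a: "coprime a (int p)" "chi a \<noteq> 1"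
    using chi nonprincipal_iff by (auto simp: nonprincipal_of_order_dvd_def)
  have pow: "chi a ^ Q = 1" "\<psi> a ^ Q' = 1" using a chi \<psi> by (auto simp: nonprincipal_of_order_dvd_def)
  have "chi a * \<psi> a \<noteq> 1"
  proof
    assume "chi a * \<psi> a = 1"
    then have "chi a ^ Q' * \<psi> a ^ Q' = 1" by (metis power_mult_distrib power_one)
    then have "chi a ^ Q' = 1" using pow by simp
    with pow have "chi a = 1" using assms eq_1_if_coprime_powers_eq_1 by blast
    with a show False by simp
  qed
  then have "(\<lambda>a. chi a * \<psi> a) \<noteq> principal_character p"
    using nonprincipal_iff[OF char] a by blast
  moreover have "(chi a * \<psi> a) ^ (Q * Q') = 1" if "coprime a (int p)" for a
  proof -
    have "(chi a * \<psi> a) ^ (Q * Q') = (chi a ^ Q) ^ Q' * (\<psi> a ^ Q') ^ Q"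
      by (simp only: power_mult_distrib power_mult[symmetric] mult.commute)
    then show ?thesis using chi \<psi> that by (simp add: nonprincipal_of_order_dvd_def)
  qed
  ultimately show ?thesis using char by (simp add: nonprincipal_of_order_dvd_def)
qed

text \<open>Combinations of non-principal characters whose order divides \<open>Q\<close>, with \<open>w\<close> the sum of the
  absolute values of the coefficients. The bound on the orders keeps products of combinations
  free of the principal character when the two values of \<open>Q\<close> are coprime.\<close>

inductive character_comb :: "nat \<Rightarrow> nat \<Rightarrow> real \<Rightarrow> (int \<Rightarrow> complex) \<Rightarrow> bool" for p Q where
  zero: "character_comb p Q 0 (\<lambda>_. 0)"
| step: "character_comb p Q w u \<Longrightarrow> nonprincipal_of_order_dvd p Q chi \<Longrightarrow>
    character_comb p Q (w + cmod c) (\<lambda>a. u a + c * chi a)"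

lemma character_comb_nonneg: "character_comb p Q w u \<Longrightarrow> w \<ge> 0"
  by (induction rule: character_comb.induct) auto

lemma character_comb_eq_0:
  "character_comb p Q w u \<Longrightarrow> \<not> coprime a (int p) \<Longrightarrow> u a = 0"
  by (induction rule: character_comb.induct)
     (auto simp: nonprincipal_of_order_dvd_def dirichlet_character_def)

lemma character_comb_add:
  assumes "character_comb p Q w u" "character_comb p Q w' v"
  shows "character_comb p Q (w + w') (\<lambda>a. u a + v a)"
  using assms(2,1)
proof (induction rule: character_comb.induct)
  case (step w' v chi c)
  then show ?case using character_comb.step[of p Q "w + w'" "\<lambda>a. u a + v a" chi c]
    by (simp add: add.assoc)
qed simp

lemma character_comb_scale:
  assumes "character_comb p Q w u"
  shows "character_comb p Q (cmod c * w) (\<lambda>a. c * u a)"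
  using assms
proof (induction rule: character_comb.induct)
  case zero
  then show ?case using character_comb.zero by simp
next
  case (step w u chi d)
  then show ?case using character_comb.step[of p Q "cmod c * w" "\<lambda>a. c * u a" chi "c * d"]
    by (simp add: distrib_left norm_mult mult.assoc)
qed

lemma character_comb_sum:
  assumes "finite I" "\<And>i. i \<in> I \<Longrightarrow> character_comb p Q (w i) (u i)"
  shows "character_comb p Q (\<Sum>i\<in>I. w i) (\<lambda>a. \<Sum>i\<in>I. u i a)"
  using assms by (induction I rule: finite_induct) (auto intro: character_comb.zero character_comb_add)

lemma character_comb_dvd:
  assumes "character_comb p Q w u" "Q dvd Q'"
  shows "character_comb p Q' w u"
  using assms(1)
proof (induction rule: character_comb.induct)
  case (step w u chi c)
  then have "nonprincipal_of_order_dvd p Q' chi"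
    using assms(2) by (auto simp: nonprincipal_of_order_dvd_def power_mult elim!: dvdE)
  with step show ?case by (intro character_comb.step)
qed (rule character_comb.zero)

lemma character_comb_mult_character:
  assumes "character_comb p Q w u" "nonprincipal_of_order_dvd p Q' \<psi>" "coprime Q Q'" "Q > 0"
  shows "character_comb p (Q * Q') w (\<lambda>a. u a * \<psi> a)"
  using assms(1)
proof (induction rule: character_comb.induct)
  case zero
  then show ?case using character_comb.zero by simp
next
  case (step w u chi c)
  then have "nonprincipal_of_order_dvd p (Q * Q') (\<lambda>a. chi a * \<psi> a)"
    using assms by (intro nonprincipal_of_order_dvd_mult)
  from character_comb.step[OF step.IH this, of c] show ?case
    by (simp add: algebra_simps)
qed

lemma character_comb_mult:
  assumes "character_comb p Q w u" "character_comb p Q' w' v" "coprime Q Q'" "Q > 0"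
  shows "character_comb p (Q * Q') (w * w') (\<lambda>a. u a * v a)"
  using assms(2)
proof (induction rule: character_comb.induct)
  case zero
  then show ?case using character_comb.zero by simp
next
  case (step w' v chi c)
  have "character_comb p (Q * Q') (cmod c * w) (\<lambda>a. c * (u a * chi a))"
    by (intro character_comb_scale character_comb_mult_character assms step)
  from character_comb_add[OF step.IH this] show ?case
    by (simp add: algebra_simps)
qed

text \<open>The principal character is kept apart because no cancellation can be expected from it:
  \<open>c\<close> is the main term, and \<open>w\<close> is the weight of what is estimated through
  character sums.\<close>

definition character_expansion ::
    "nat \<Rightarrow> nat \<Rightarrow> real \<Rightarrow> real \<Rightarrow> (int \<Rightarrow> complex) \<Rightarrow> bool" where
  "character_expansion p Q c w f \<longleftrightarrow>
     (\<exists>u. character_comb p Q w u \<and> f = (\<lambda>a. of_real c * principal_character p a + u a))"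

text \<open>Multiply out. The principal character acts as the identity on combinations, which vanish
  off the units, and by coprimality the product of the two combinations has no principal part. The
  sum of main term and weight is thus multiplicative for nonnegative main terms.\<close>

lemma character_expansion_mult:
  assumes "character_expansion p Q c w f" "character_expansion p Q' c' w' g" "coprime Q Q'" "Q > 0"
  shows "character_expansion p (Q * Q') (c * c') (\<bar>c\<bar> * w' + \<bar>c'\<bar> * w + w * w') (\<lambda>a. f a * g a)"
proof -
  obtain u where u: "character_comb p Q w u" "f = (\<lambda>a. of_real c * principal_character p a + u a)"
    using assms(1) by (auto simp: character_expansion_def)
  obtain v where v: "character_comb p Q' w' v" "g = (\<lambda>a. of_real c' * principal_character p a + v a)"
    using assms(2) by (auto simp: character_expansion_def)
  have "character_comb p (Q * Q') (\<bar>c\<bar> * w' + \<bar>c'\<bar> * w + w * w')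
      (\<lambda>a. of_real c * v a + of_real c' * u a + u a * v a)"
    using character_comb_scale[OF v(1), of "of_real c"] character_comb_scale[OF u(1), of "of_real c'"]
      character_comb_mult[OF u(1) v(1) assms(3,4)]
    by (auto intro!: character_comb_add elim: character_comb_dvd)
  moreover have "f a * g a = of_real (c * c') * principal_character p a +
      (of_real c * v a + of_real c' * u a + u a * v a)" for a
    using character_comb_eq_0[OF u(1), of a] character_comb_eq_0[OF v(1), of a]
    by (cases "coprime a (int p)") (simp_all add: u(2) v(2) principal_character_def algebra_simps)
  ultimately show ?thesis by (auto simp: character_expansion_def)
qed

lemma character_expansion_principal: "character_expansion p Q c 0 (\<lambda>a. of_real c * principal_character p a)"
  unfolding character_expansion_def by (rule exI[of _ "\<lambda>_. 0"]) (auto intro: character_comb.zero)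

lemma character_expansion_add:
  assumes "character_expansion p Q c w f" "character_expansion p Q c' w' g"
  shows "character_expansion p Q (c + c') (w + w') (\<lambda>a. f a + g a)"
proof -
  obtain u v where u: "character_comb p Q w u" "f = (\<lambda>a. of_real c * principal_character p a + u a)"
    and v: "character_comb p Q w' v" "g = (\<lambda>a. of_real c' * principal_character p a + v a)"
    using assms by (auto simp: character_expansion_def)
  show ?thesis unfolding character_expansion_def
    by (rule exI, rule conjI, rule character_comb_add[OF u(1) v(1)]) (simp add: u v algebra_simps)
qed

lemma character_expansion_sum:
  assumes "finite I" "\<And>i. i \<in> I \<Longrightarrow> character_expansion p Q (c i) (w i) (f i)"
  shows "character_expansion p Q (\<Sum>i\<in>I. c i) (\<Sum>i\<in>I. w i) (\<lambda>a. \<Sum>i\<in>I. f i a)"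
  using assms
proof (induction I rule: finite_induct)
  case empty
  then show ?case using character_expansion_principal[of p Q 0] by simp
qed (auto intro!: character_expansion_add)

lemma character_expansion_dvd:
  "character_expansion p Q c w f \<Longrightarrow> Q dvd Q' \<Longrightarrow> character_expansion p Q' c w f"
  unfolding character_expansion_def using character_comb_dvd by blast

section \<open>Character expansions of power nonresidue indicators\<close>

text \<open>For a prime \<open>p\<close> and \<open>q\<close> dividing \<open>p - 1\<close>, Euler's
  criterion makes this the indicator of the units that are not \<open>q\<close>-th powers.\<close>

definition power_nonresidue :: "nat \<Rightarrow> nat \<Rightarrow> int \<Rightarrow> complex" where
  "power_nonresidue p q a =
     (if coprime a (int p) \<and> \<not> [a ^ ((p - 1) div q) = 1] (mod int p) then 1 else 0)"

text \<open>Take a primitive root \<open>g\<close> and send \<open>g ^ k\<close> to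
  \<open>exp (2 pi i k / q)\<close>; this is well defined because \<open>k\<close> is determined
  modulo \<open>p - 1\<close>, a multiple of \<open>q\<close>.\<close>

lemma power_residue_character_exists:
  assumes "prime p" "prime q" "q dvd p - 1"
  obtains \<psi> where "dirichlet_character p \<psi>"
    "\<And>a. coprime a (int p) \<Longrightarrow> \<psi> a ^ q = 1"
    "\<And>a. coprime a (int p) \<Longrightarrow> \<psi> a = 1 \<longleftrightarrow> [a ^ ((p - 1) div q) = 1] (mod int p)"
    "\<exists>a. coprime a (int p) \<and> \<psi> a \<noteq> 1"
proof -
  have p1: "p > 1" using assms prime_gt_1_nat by auto
  obtain g where g: "residue_primroot p g" using prime_primitive_root_exists[OF p1 assms(1)] by blast
  have q: "q > 1" using assms prime_gt_1_nat by auto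
  have tot: "totient p = p - 1" using assms by (simp add: totient_prime)
  have copg: "coprime p g" and ord: "ord p g = p - 1"
    using g tot by (auto simp: residue_primroot_def)
  have copg': "coprime (int g ^ k) (int p)" for k
    using copg by (simp add: coprime_commute)
  have log_ex: "\<exists>k. [int g ^ k = a] (mod int p)" if "coprime a (int p)" for a
  proof -
    define b where "b = nat (a mod int p)"
    have b: "int b = a mod int p" using p1 by (simp add: b_def)
    have "coprime (int b) (int p)" using that b p1 by (simp add: coprime_commute)
    then have "coprime b p" by simp
    moreover have "b < p" using b p1 by (simp add: b_def nat_less_iff)
    ultimately have "b \<in> totatives p" using p1 by (auto simp: totatives_def intro!: Nat.gr0I)
    then obtain k where "b = g ^ k mod p"
      using residue_primroot_is_generator[OF p1 g] by (auto simp: bij_betw_def)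
    then have "int g ^ k mod int p = a mod int p" using b by (metis of_nat_mod of_nat_power)
    then have "[int g ^ k = a] (mod int p)" by (simp add: Cong.cong_def)
    then show ?thesis ..
  qed
  have log_unique: "[i = j] (mod (p - 1))" if "[int g ^ i = int g ^ j] (mod int p)" for i j
  proof -
    have "[g ^ i = g ^ j] (mod p)" using that by (metis cong_int_iff of_nat_power)
    then show ?thesis using order_divides_expdiff[OF copg] ord by simp
  qed
  define dlog where "dlog = (\<lambda>a. SOME k. [int g ^ k = a] (mod int p))"
  have dlog: "[int g ^ dlog a = a] (mod int p)" if "coprime a (int p)" for a
    unfolding dlog_def using log_ex[OF that] by (rule someI_ex)
  have dlog_eq: "[dlog a = k] (mod (p - 1))" if "coprime a (int p)" "[int g ^ k = a] (mod int p)" for a k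
    using dlog[OF that(1)] that(2) by (intro log_unique) (metis cong_trans cong_sym)
  define \<zeta> where "\<zeta> = (\<lambda>k::nat. exp (2 * of_real pi * \<i> * of_nat k / of_nat q))"
  have zeta_eq: "\<zeta> i = \<zeta> j \<longleftrightarrow> [i = j] (mod q)" for i j
    unfolding \<zeta>_def Cong.cong_def using q by (intro complex_root_unity_eq) simp
  have zeta_cong: "\<zeta> i = \<zeta> j" if "[i = j] (mod (p - 1))" for i j
    unfolding zeta_eq using that assms(3) by (rule cong_dvd_modulus_nat)
  have zeta_add: "\<zeta> (i + j) = \<zeta> i * \<zeta> j" for i j
    by (simp add: \<zeta>_def exp_add[symmetric] distrib_left add_divide_distrib)
  have zeta_0: "\<zeta> 0 = 1" by (simp add: \<zeta>_def)
  have zeta_1: "\<zeta> i = 1 \<longleftrightarrow> q dvd i" for i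
    using zeta_eq[of i 0] by (simp add: zeta_0 cong_0_iff)
  define \<psi> where "\<psi> = (\<lambda>a. if coprime a (int p) then \<zeta> (dlog a) else 0)"
  have psi: "\<psi> a = \<zeta> k" if "coprime a (int p)" "[int g ^ k = a] (mod int p)" for a k
    using zeta_cong[OF dlog_eq[OF that]] that by (simp add: \<psi>_def)
  show thesis
  proof
    have "\<psi> (a + int p) = \<psi> a" for a
    proof (cases "coprime a (int p)")
      case True
      have "coprime (a + int p) (int p)" using True by (simp add: coprime_iff_gcd_eq_1)
      moreover have "[int g ^ dlog a = a + int p] (mod int p)" using dlog[OF True] by (simp add: Cong.cong_def)
      ultimately show ?thesis using psi True by (simp add: \<psi>_def)
    next
      case False
      then show ?thesis by (simp add: \<psi>_def coprime_iff_gcd_eq_1)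
    qed
    moreover have "\<psi> (a * b) = \<psi> a * \<psi> b" for a b
    proof (cases "coprime a (int p) \<and> coprime b (int p)")
      case True
      then have "[int g ^ (dlog a + dlog b) = a * b] (mod int p)"
        unfolding power_add by (intro cong_mult dlog) auto
      then have "\<psi> (a * b) = \<zeta> (dlog a + dlog b)" using True by (intro psi) auto
      then show ?thesis using True by (simp add: zeta_add \<psi>_def)
    qed (auto simp: \<psi>_def)
    ultimately show "dirichlet_character p \<psi>"
      by (auto simp: dirichlet_character_def \<psi>_def \<zeta>_def)
    show "\<psi> a ^ q = 1" if "coprime a (int p)" for a
    proof -
      have "\<zeta> k ^ n = \<zeta> (n * k)" for k n by (induction n) (simp_all add: zeta_0 zeta_add)
      then show ?thesis using that by (simp add: \<psi>_def zeta_1)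
    qed
    show "\<psi> a = 1 \<longleftrightarrow> [a ^ ((p - 1) div q) = 1] (mod int p)" if a: "coprime a (int p)" for a
    proof -
      define r where "r = (p - 1) div q"
      have "p - 1 = r * q" using assms by (simp add: r_def)
      moreover from this have "r > 0" using p1 by (intro Nat.gr0I) auto
      ultimately have r: "p - 1 = r * q" "r > 0" by auto
      \<comment> \<open>As \<open>p - 1 = r * q\<close>, the order of \<open>g\<close> divides
        \<open>dlog a * r\<close> exactly when \<open>q\<close> divides
        \<open>dlog a\<close>.\<close>
      have "[a ^ r = int g ^ (dlog a * r)] (mod int p)"
        unfolding power_mult by (intro cong_pow cong_sym[OF dlog] a)
      then have "[a ^ r = 1] (mod int p) \<longleftrightarrow> [int g ^ (dlog a * r) = 1] (mod int p)"
        by (simp add: Cong.cong_def)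
      also have "\<dots> \<longleftrightarrow> [g ^ (dlog a * r) = 1] (mod p)"
        by (metis cong_int_iff of_nat_power of_nat_1)
      also have "\<dots> \<longleftrightarrow> q dvd dlog a" unfolding ord_divides ord using r by simp
      finally show ?thesis using a by (simp add: r_def \<psi>_def zeta_1)
    qed
    show "\<exists>a. coprime a (int p) \<and> \<psi> a \<noteq> 1"
      using psi[of "int g" 1] copg'[of 1] q by (intro exI[of _ "int g"]) (simp add: zeta_1)
  qed
qed

text \<open>The mean of the powers \<open>\<psi> ^ j\<close>, \<open>j < q\<close>, is the indicator
  of the \<open>q\<close>-th powers. Its complement has main term \<open>1 - 1 / q\<close> and
  \<open>q - 1\<close> non-principal characters with coefficient \<open>- 1 / q\<close>.\<close>

lemma character_expansion_power_nonresidue: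
  assumes "prime p" "prime q" "q dvd p - 1"
  shows "character_expansion p q (1 - 1 / real q) (1 - 1 / real q) (power_nonresidue p q)"
proof -
  obtain \<psi> where psi: "dirichlet_character p \<psi>"
    "\<And>a. coprime a (int p) \<Longrightarrow> \<psi> a ^ q = 1"
    "\<And>a. coprime a (int p) \<Longrightarrow> \<psi> a = 1 \<longleftrightarrow> [a ^ ((p - 1) div q) = 1] (mod int p)"
    "\<exists>a. coprime a (int p) \<and> \<psi> a \<noteq> 1"
    using power_residue_character_exists[OF assms] by blast
  have q: "q > 1" using assms prime_gt_1_nat by auto
  have nonprinc: "nonprincipal_of_order_dvd p q (\<lambda>a. \<psi> a ^ j)" if j: "j \<in> {1..<q}" for j
  proof -
    obtain a where a: "coprime a (int p)" "\<psi> a \<noteq> 1" using psi(4) by blast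
    have "coprime q j" using j assms(2) by (intro prime_imp_coprime) (auto dest: dvd_imp_le)
    then have "\<psi> a ^ j \<noteq> 1" using a psi(2) eq_1_if_coprime_powers_eq_1[of "\<psi> a" q j] q by auto
    moreover have "dirichlet_character p (\<lambda>a. \<psi> a ^ j)"
      using j by (intro dirichlet_character_power psi(1)) auto
    moreover have "(\<psi> a ^ j) ^ q = 1" if "coprime a (int p)" for a
      using psi(2)[OF that] by (metis mult.commute power_mult power_one)
    ultimately show ?thesis using a nonprincipal_iff by (auto simp: nonprincipal_of_order_dvd_def)
  qed
  have "character_comb p q (\<Sum>j\<in>{1..<q}. 1 / real q) (\<lambda>a. \<Sum>j\<in>{1..<q}. of_real (- 1 / real q) * \<psi> a ^ j)"
  proof (rule character_comb_sum)
    fix j assume "j \<in> {1..<q}"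
    from character_comb.step[OF character_comb.zero nonprinc[OF this], of "of_real (- 1 / real q)"]
    show "character_comb p q (1 / real q) (\<lambda>a. of_real (- 1 / real q) * \<psi> a ^ j)"
      by (simp add: norm_divide)
  qed auto
  also have "(\<Sum>j\<in>{1..<q}. 1 / real q) = 1 - 1 / real q"
    using q by (simp add: of_nat_diff field_simps)
  finally have comb: "character_comb p q (1 - 1 / real q)
     (\<lambda>a. \<Sum>j\<in>{1..<q}. of_real (- 1 / real q) * \<psi> a ^ j)" .
  have "power_nonresidue p q a = of_real (1 - 1 / real q) * principal_character p a +
      (\<Sum>j\<in>{1..<q}. of_real (- 1 / real q) * \<psi> a ^ j)" for a
  proof (cases "coprime a (int p)")
    case True
    have "(\<Sum>j<q. \<psi> a ^ j) = 1 + (\<Sum>j\<in>{1..<q}. \<psi> a ^ j)"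
      using q by (simp add: lessThan_atLeast0 sum.atLeast_Suc_lessThan)
    moreover have "(\<Sum>j<q. \<psi> a ^ j) = (if \<psi> a = 1 then of_nat q else 0)"
      using psi(2)[OF True] by (simp add: geometric_sum)
    ultimately have "(\<Sum>j\<in>{1..<q}. \<psi> a ^ j) = (if \<psi> a = 1 then of_nat q else 0) - 1"
      by (simp add: algebra_simps)
    then have "(\<Sum>j\<in>{1..<q}. of_real (- 1 / real q) * \<psi> a ^ j) =
        of_real (- 1 / real q) * ((if \<psi> a = 1 then of_nat q else 0) - 1)"
      by (simp only: sum_distrib_left[symmetric])
    then show ?thesis using True q psi(3)[OF True]
      by (simp only: power_nonresidue_def principal_character_def) (auto simp: field_simps)
  next
    case False
    then have "\<psi> a = 0" using psi(1) by (auto simp: dirichlet_character_def)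
    then have "(\<Sum>j\<in>{1..<q}. of_real (- 1 / real q) * \<psi> a ^ j) = 0"
      by (intro sum.neutral) (simp add: zero_power)
    then show ?thesis using False by (simp add: power_nonresidue_def principal_character_def)
  qed
  with comb show ?thesis unfolding character_expansion_def by blast
qed

text \<open>Every factor has main term and weight both equal to \<open>1 - 1 / q\<close>, so main
  term plus weight is the product of \<open>2 * (1 - 1 / q)\<close>. The principal factor supplies
  the right value off the units when \<open>E\<close> is empty.\<close>

lemma character_expansion_prod_power_nonresidue:
  assumes "prime p" "finite E" "\<And>q. q \<in> E \<Longrightarrow> prime q \<and> q dvd p - 1"
  shows "character_expansion p (\<Prod>E) (\<Prod>q\<in>E. 1 - 1 / real q)
    ((\<Prod>q\<in>E. 1 - 1 / real q) * (2 ^ card E - 1))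
    (\<lambda>a. principal_character p a * (\<Prod>q\<in>E. power_nonresidue p q a))"
  using assms(2,3)
proof (induction E rule: finite_induct)
  case empty
  then show ?case using character_expansion_principal[of p 1 1] by simp
next
  case (insert q E)
  have q: "q > 1" using insert prime_gt_1_nat by auto
  have pos: "(\<Prod>q\<in>E. 1 - 1 / real q) \<ge> 0"
  proof (intro prod_nonneg)
    fix a assume "a \<in> E"
    then have "a > 0" using insert.prems[of a] prime_gt_0_nat by auto
    then show "0 \<le> 1 - 1 / real a" by simp
  qed
  have "coprime q (\<Prod>E)"
    using insert by (intro prod_coprime_right) (metis insertCI primes_coprime)
  then have "character_expansion p (q * \<Prod>E) ((1 - 1 / real q) * (\<Prod>q\<in>E. 1 - 1 / real q))
    (\<bar>1 - 1 / real q\<bar> * ((\<Prod>q\<in>E. 1 - 1 / real q) * (2 ^ card E - 1)) +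
     \<bar>\<Prod>q\<in>E. 1 - 1 / real q\<bar> * (1 - 1 / real q) +
     (1 - 1 / real q) * ((\<Prod>q\<in>E. 1 - 1 / real q) * (2 ^ card E - 1)))
    (\<lambda>a. power_nonresidue p q a * (principal_character p a * (\<Prod>q\<in>E. power_nonresidue p q a)))"
    using insert q assms(1)
    by (intro character_expansion_mult character_expansion_power_nonresidue) auto
  also have "\<bar>1 - 1 / real q\<bar> * ((\<Prod>q\<in>E. 1 - 1 / real q) * (2 ^ card E - 1)) +
     \<bar>\<Prod>q\<in>E. 1 - 1 / real q\<bar> * (1 - 1 / real q) +
     (1 - 1 / real q) * ((\<Prod>q\<in>E. 1 - 1 / real q) * (2 ^ card E - 1)) =
     (1 - 1 / real q) * (\<Prod>q\<in>E. 1 - 1 / real q) * (2 * 2 ^ card E - 1)"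
  proof -
    have "\<bar>t\<bar> * (\<theta> * (c - 1)) + \<bar>\<theta>\<bar> * t + t * (\<theta> * (c - 1)) = t * \<theta> * (2 * c - 1)"
      if "t \<ge> 0" "\<theta> \<ge> 0" for t \<theta> c :: real
      using that by (simp add: algebra_simps)
    moreover have "1 - 1 / real q \<ge> 0" using q by simp
    ultimately show ?thesis using pos by blast
  qed
  finally show ?case using insert.hyps by (simp add: mult.left_commute)
qed


section \<open>Even moments of character combinations\<close>

lemma convex_power_mean:
  fixes a b x y :: real
  assumes "even k" "k > 0" "a > 0" "b > 0"
  shows "(a * x + b * y) ^ k \<le> (a + b) ^ (k - 1) * (a * x ^ k + b * y ^ k)"
proof -
  \<comment> \<open>Normalising the weights by \<open>a + b\<close> makes the argument a convex
    combination, to which convexity of the even power applies.\<close>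
  define t where "t = b / (a + b)"
  have t: "0 \<le> t" "t \<le> 1" "(a + b) * t = b" "(a + b) * (1 - t) = a"
    using assms by (simp_all add: t_def field_simps)
  have "a * x + b * y = (a + b) * ((1 - t) * x + t * y)"
    unfolding distrib_left mult.assoc[symmetric] t ..
  then have "(a * x + b * y) ^ k = (a + b) ^ k * ((1 - t) * x + t * y) ^ k"
    by (simp only: power_mult_distrib)
  also have "\<dots> \<le> (a + b) ^ k * ((1 - t) * x ^ k + t * y ^ k)"
    using convex_onD[OF convex_power_even[OF assms(1)], of t x y] t(1,2) assms
    by (intro mult_left_mono) auto
  also have "\<dots> = (a + b) ^ (k - 1) * ((a + b) * (1 - t) * x ^ k + (a + b) * t * y ^ k)"
    using assms(2) by (simp add: power_eq_if[of _ k] algebra_simps)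
  finally show ?thesis by (simp only: t)
qed

text \<open>Minkowski's inequality stated without roots: the \<open>k\<close>-norms of
  \<open>f\<close> and \<open>g\<close> are measured in units of the \<open>k\<close>-th root of
  \<open>K\<close>.\<close>

lemma sum_power_minkowski:
  fixes f g :: "'a \<Rightarrow> real"
  assumes "even k" "k > 0" "finite S" "a \<ge> 0" "b \<ge> 0"
    and f: "(\<Sum>x\<in>S. f x ^ k) \<le> a ^ k * K"
    and g: "(\<Sum>x\<in>S. g x ^ k) \<le> K"
  shows "(\<Sum>x\<in>S. (f x + b * g x) ^ k) \<le> (a + b) ^ k * K"
proof -
  consider "b = 0" | "a = 0" | "a > 0" "b > 0" using assms by force
  then show ?thesis
  proof cases
    case 1
    then show ?thesis using f by simp
  next
    case 2
    then have "(\<Sum>x\<in>S. f x ^ k) = 0"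
      using f assms by (intro antisym sum_nonneg) (auto simp: zero_le_even_power zero_power)
    then have "f x = 0" if "x \<in> S" for x
      using that assms by (subst (asm) sum_nonneg_eq_0_iff) (auto simp: zero_le_even_power)
    then have "(\<Sum>x\<in>S. (f x + b * g x) ^ k) = b ^ k * (\<Sum>x\<in>S. g x ^ k)"
      by (simp add: power_mult_distrib sum_distrib_left)
    also have "\<dots> \<le> b ^ k * K" using g assms by (intro mult_left_mono) auto
    finally show ?thesis using 2 by simp
  next
    case 3
    \<comment> \<open>Rescaling \<open>f\<close> to \<open>f / a\<close> gives both functions the
      same moment bound \<open>K\<close>; convexity is used with weights \<open>a\<close> and
      \<open>b\<close>.\<close>
    have "(\<Sum>x\<in>S. (f x + b * g x) ^ k) \<le>
        (\<Sum>x\<in>S. (a + b) ^ (k - 1) * (a * (f x / a) ^ k + b * g x ^ k))"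
      using convex_power_mean[OF assms(1,2) 3, of "f x / a" for x] 3 by (intro sum_mono) simp
    also have "\<dots> = (a + b) ^ (k - 1) * (a / a ^ k * (\<Sum>x\<in>S. f x ^ k) + b * (\<Sum>x\<in>S. g x ^ k))"
      by (simp add: sum_distrib_left[symmetric] sum.distrib power_divide sum_divide_distrib[symmetric])
    also have "\<dots> \<le> (a + b) ^ (k - 1) * (a / a ^ k * (a ^ k * K) + b * K)"
      using f g 3 by (intro mult_left_mono add_mono) auto
    also have "\<dots> = (a + b) ^ (k - 1) * ((a + b) * K)"
      using 3 by (simp add: algebra_simps)
    also have "\<dots> = (a + b) ^ k * K"
      using assms(2) by (simp add: power_eq_if[of _ k])
    finally show ?thesis .
  qed
qed

text \<open>\<open>G x\<close> is the sum of \<open>cmod c\<close> times the modulus of the block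
  sum of \<open>chi\<close> at \<open>x\<close>. A dilation \<open>b\<close> only contributes the
  factor \<open>chi b\<close> of modulus at most 1, so one \<open>G\<close> serves all
  \<open>b\<close> at once.\<close>

lemma character_comb_power_mean:
  assumes "character_comb p Q w u" "Q > 0" "even k" "k > 0"
    and W: "\<And>chi. dirichlet_character p chi \<Longrightarrow> chi \<noteq> principal_character p \<Longrightarrow>
      (\<Sum>x\<in>{0..<int p}. cmod (\<Sum>n<h. chi (x + int n)) ^ k) \<le> K"
  obtains G :: "int \<Rightarrow> real" where
    "\<forall>x b. cmod (\<Sum>n<h. u (b * (x + int n))) \<le> G x"
    "(\<Sum>x\<in>{0..<int p}. G x ^ k) \<le> w ^ k * K"
proof -
  have "\<exists>G. (\<forall>x b. cmod (\<Sum>n<h. u (b * (x + int n))) \<le> G x) \<and>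
      (\<Sum>x\<in>{0..<int p}. G x ^ k) \<le> w ^ k * K"
    using assms(1)
  proof (induction rule: character_comb.induct)
    case zero
    then show ?case using \<open>k > 0\<close> by (intro exI[of _ "\<lambda>_. 0"]) (simp add: zero_power)
  next
    case (step w u chi c)
    obtain G where G: "\<And>x b. cmod (\<Sum>n<h. u (b * (x + int n))) \<le> G x"
      "(\<Sum>x\<in>{0..<int p}. G x ^ k) \<le> w ^ k * K"
      using step.IH by blast
    have chi: "dirichlet_character p chi" "chi \<noteq> principal_character p"
      "\<And>a. coprime a (int p) \<Longrightarrow> chi a ^ Q = 1"
      using step.hyps by (auto simp: nonprincipal_of_order_dvd_def)
    have mult: "chi (a * b) = chi a * chi b" for a b
      using chi(1) by (auto simp: dirichlet_character_def)
    \<comment> \<open>On the units the values are \<open>Q\<close>-th roots of unity, elsewhere they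
      are 0.\<close>
    have norm: "cmod (chi b) \<le> 1" for b
    proof (cases "coprime b (int p)")
      case True
      then have "cmod (chi b) ^ Q = 1" using chi(3) by (metis norm_one norm_power)
      then show ?thesis using \<open>Q > 0\<close> power_eq_imp_eq_base[of "cmod (chi b)" Q 1] by simp
    next
      case False
      then have "chi b = 0" using chi(1) by (auto simp: dirichlet_character_def)
      then show ?thesis by simp
    qed
    define S where "S = (\<lambda>x. cmod (\<Sum>n<h. chi (x + int n)))"
    have "cmod (\<Sum>n<h. u (b * (x + int n)) + c * chi (b * (x + int n))) \<le> G x + cmod c * S x" for x b
    proof -
      have "(\<Sum>n<h. c * chi (b * (x + int n))) = c * (chi b * (\<Sum>n<h. chi (x + int n)))"
        by (simp add: mult sum_distrib_left)
      then have "cmod (\<Sum>n<h. c * chi (b * (x + int n))) = cmod c * (cmod (chi b) * S x)"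
        by (simp add: norm_mult S_def)
      also have "\<dots> \<le> cmod c * (1 * S x)"
        using norm by (intro mult_left_mono mult_right_mono) (auto simp: S_def)
      finally show ?thesis
        unfolding sum.distrib using G(1)[of b x] by (intro norm_triangle_le) simp
    qed
    moreover have "(\<Sum>x\<in>{0..<int p}. (G x + cmod c * S x) ^ k) \<le> (w + cmod c) ^ k * K"
      using G(2) W[OF chi(1,2)] assms character_comb_nonneg[OF step.hyps(1)]
      by (intro sum_power_minkowski) (auto simp: S_def)
    ultimately show ?case by (intro exI[of _ "\<lambda>x. G x + cmod c * S x"]) blast
  qed
  then show thesis using that by blast
qed

text \<open>Since \<open>p\<close> is odd, a quadratic non-principal character exists, and its
  moment is a nonnegative number below \<open>K\<close>.\<close>

lemma character_sum_bound_nonneg: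
  assumes "prime p" "odd p" "even k"
    and W: "\<And>chi. dirichlet_character p chi \<Longrightarrow> chi \<noteq> principal_character p \<Longrightarrow>
      (\<Sum>x\<in>{0..<int p}. cmod (\<Sum>n<h. chi (x + int n)) ^ k) \<le> K"
  shows "K \<ge> 0"
proof -
  have "2 dvd p - 1" using assms by simp
  from power_residue_character_exists[OF assms(1) two_is_prime_nat this]
  obtain \<psi> where "dirichlet_character p \<psi>" "\<exists>a. coprime a (int p) \<and> \<psi> a \<noteq> 1"
    by metis
  then have "(\<Sum>x\<in>{0..<int p}. cmod (\<Sum>n<h. \<psi> (x + int n)) ^ k) \<le> K"
    using nonprincipal_iff by (intro W) auto
  moreover have "0 \<le> (\<Sum>x\<in>{0..<int p}. cmod (\<Sum>n<h. \<psi> (x + int n)) ^ k)"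
    by (intro sum_nonneg) auto
  ultimately show ?thesis by linarith
qed

section \<open>The sieve for primitive roots\<close>

lemma not_primroot_imp_power_residue:
  assumes "prime p" "coprime p m" "\<not> residue_primroot p m"
  obtains q where "prime q" "q dvd p - 1" "[int m ^ ((p - 1) div q) = 1] (mod int p)"
proof -
  have p1: "p > 1" using assms prime_gt_1_nat by auto
  have tot: "totient p = p - 1" using assms by (simp add: totient_prime)
  have "ord p m dvd p - 1" using order_divides_totient[OF assms(2)] tot by simp
  then obtain k where k: "p - 1 = ord p m * k" by auto
  \<comment> \<open>The cofactor \<open>k\<close> of the order exceeds 1; removing one of its primes
    \<open>q\<close> from \<open>p - 1\<close> leaves a multiple of the order.\<close>
  have "ord p m \<noteq> p - 1" using assms p1 tot by (auto simp: residue_primroot_def)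
  then have "k \<noteq> 1" using k by auto
  then obtain q where q: "prime q" "q dvd k" using prime_factor_nat by blast
  then obtain l where l: "k = q * l" by auto
  have "(p - 1) div q = ord p m * l" using k l q by (simp add: prime_gt_0_nat)
  then have "[m ^ ((p - 1) div q) = 1] (mod p)" unfolding ord_divides by simp
  then have "[int m ^ ((p - 1) div q) = 1] (mod int p)"
    by (metis cong_int_iff of_nat_power of_nat_1)
  then show thesis using that q k l by auto
qed

text \<open>The sieve function \<open>F\<close> is the product of the indicators over
  \<open>E\<close> times their sum over \<open>P\<close> minus \<open>s - 1\<close>. At a non-root
  some indicator is 0: for a prime in \<open>E\<close> the product vanishes, for one in
  \<open>P\<close> the sum is at most \<open>s - 1\<close>. Either way
  \<open>F \<le> 0\<close>.\<close>

lemma primitive_root_sieve: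
  fixes p e :: nat
  assumes "prime p"
  defines "P \<equiv> {q. prime q \<and> q dvd p - 1 \<and> \<not> q dvd e}"
  defines "E \<equiv> {q. prime q \<and> q dvd p - 1 \<and> q dvd e}"
  defines "\<delta> \<equiv> 1 - (\<Sum>q\<in>P. 1 / real q)"
  assumes "\<delta> > 0"
  obtains Q u where "Q > 0"
    "character_comb p Q ((2 * \<delta> + real (card P) - 1) * 2 ^ card E - \<delta>) u"
    "\<forall>m. coprime p m \<and> \<not> residue_primroot p m \<longrightarrow> Re (u (int m)) \<le> - \<delta>"
proof -
  have p1: "p > 1" using assms prime_gt_1_nat by auto
  have "{q. q dvd p - 1} \<subseteq> {..p - 1}" using p1 by (auto dest: dvd_imp_le)
  then have fin: "finite P" "finite E" unfolding P_def E_def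
    by (auto intro: finite_subset[of _ "{..p - 1}"])
  define s where "s = real (card P)"
  define \<theta> where "\<theta> = (\<Prod>q\<in>E. 1 - 1 / real q)"
  have \<theta>: "\<theta> > 0" unfolding \<theta>_def
    by (intro prod_pos) (auto simp: E_def dest!: prime_gt_1_nat)
  define N where "N = power_nonresidue p"
  have "character_expansion p (\<Prod>P) (1 - 1 / real q) (1 - 1 / real q) (N q)" if "q \<in> P" for q
    using that assms fin unfolding N_def
    by (intro character_expansion_dvd[OF character_expansion_power_nonresidue[of p q]] dvd_prodI)
       (auto simp: P_def)
  from character_expansion_sum[OF fin(1) this]
  have "character_expansion p (\<Prod>P) (\<Sum>q\<in>P. 1 - 1 / real q) (\<Sum>q\<in>P. 1 - 1 / real q) (\<lambda>a. \<Sum>q\<in>P. N q a)" .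
  also have "(\<Sum>q\<in>P. 1 - 1 / real q) = s - 1 + \<delta>"
    by (simp add: sum_subtractf s_def \<delta>_def)
  \<comment> \<open>Subtracting \<open>s - 1\<close> times the principal character lowers the main
    term to \<open>\<delta>\<close> without adding weight.\<close>
  finally have "character_expansion p (\<Prod>P) (s - 1 + \<delta> + (1 - s)) (s - 1 + \<delta> + 0)
      (\<lambda>a. (\<Sum>q\<in>P. N q a) + of_real (1 - s) * principal_character p a)"
    by (rule character_expansion_add[OF _ character_expansion_principal])
  then have P: "character_expansion p (\<Prod>P) \<delta> (s - 1 + \<delta>)
      (\<lambda>a. (\<Sum>q\<in>P. N q a) + of_real (1 - s) * principal_character p a)" by simp
  have E: "character_expansion p (\<Prod>E) \<theta> (\<theta> * (2 ^ card E - 1))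
      (\<lambda>a. principal_character p a * (\<Prod>q\<in>E. N q a))"
    unfolding \<theta>_def N_def
    by (rule character_expansion_prod_power_nonresidue[OF assms(1) fin(2)]) (auto simp: E_def)
  define F where "F = (\<lambda>a. principal_character p a * (\<Prod>q\<in>E. N q a) *
      ((\<Sum>q\<in>P. N q a) + of_real (1 - s) * principal_character p a))"
  have "coprime (\<Prod>E) (\<Prod>P)"
    by (intro prod_coprime_left prod_coprime_right primes_coprime) (auto simp: P_def E_def)
  moreover have E0: "\<Prod>E > 0" by (intro prod_pos) (auto simp: E_def prime_gt_0_nat)
  ultimately have "character_expansion p (\<Prod>E * \<Prod>P) (\<theta> * \<delta>)
      (\<bar>\<theta>\<bar> * (s - 1 + \<delta>) + \<bar>\<delta>\<bar> * (\<theta> * (2 ^ card E - 1)) + \<theta> * (2 ^ card E - 1) * (s - 1 + \<delta>)) F"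
    unfolding F_def by (intro character_expansion_mult E P)
  \<comment> \<open>Main term plus weight is \<open>\<theta> * 2 ^ card E\<close> for
    \<open>E\<close> and \<open>2 * \<delta> + s - 1\<close> for \<open>P\<close>; the product minus
    the main term \<open>\<theta> * \<delta>\<close> is the new weight.\<close>
  also have "\<bar>\<theta>\<bar> * (s - 1 + \<delta>) + \<bar>\<delta>\<bar> * (\<theta> * (2 ^ card E - 1)) + \<theta> * (2 ^ card E - 1) * (s - 1 + \<delta>)
      = \<theta> * ((2 * \<delta> + s - 1) * 2 ^ card E - \<delta>)"
    using \<theta> \<open>\<delta> > 0\<close> by (simp add: algebra_simps)
  finally obtain v where v: "character_comb p (\<Prod>E * \<Prod>P) (\<theta> * ((2 * \<delta> + s - 1) * 2 ^ card E - \<delta>)) v"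
    "F = (\<lambda>a. of_real (\<theta> * \<delta>) * principal_character p a + v a)"
    by (auto simp: character_expansion_def)
  have P0: "\<Prod>P > 0" by (intro prod_pos) (auto simp: P_def prime_gt_0_nat)
  show thesis
  proof
    show "\<Prod>E * \<Prod>P > 0" using E0 P0 by simp
    \<comment> \<open>Division by \<open>\<theta>\<close> normalises the main term of
      \<open>F\<close> to \<open>\<delta>\<close>.\<close>
    show "character_comb p (\<Prod>E * \<Prod>P) ((2 * \<delta> + real (card P) - 1) * 2 ^ card E - \<delta>) (\<lambda>a. of_real (1 / \<theta>) * v a)"
      using character_comb_scale[OF v(1), of "of_real (1 / \<theta>)"] \<theta>
      by (simp add: s_def norm_divide)
    have "Re (of_real (1 / \<theta>) * v (int m)) \<le> - \<delta>"
      if m: "coprime p m" "\<not> residue_primroot p m" for m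
    proof -
      have cop: "coprime (int m) (int p)" using m by (simp add: coprime_commute)
      obtain q where q: "prime q" "q dvd p - 1" "[int m ^ ((p - 1) div q) = 1] (mod int p)"
        using not_primroot_imp_power_residue[OF assms(1) m] .
      then have Nq: "N q (int m) = 0" by (simp add: N_def power_nonresidue_def)
      have "Re (F (int m)) \<le> 0"
      proof (cases "q dvd e")
        case True
        then have "q \<in> E" using q by (simp add: E_def)
        then have "(\<Prod>q\<in>E. N q (int m)) = 0" using Nq fin by (auto intro!: prod_zero)
        then show ?thesis by (simp add: F_def)
      next
        case False
        then have qP: "q \<in> P" using q by (simp add: P_def)
        define n where "n = (\<lambda>q. if [int m ^ ((p - 1) div q) = 1] (mod int p) then 0 else 1 :: real)"
        have n: "N q (int m) = of_real (n q)" for q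
          using cop by (simp add: N_def power_nonresidue_def n_def)
        have "(\<Sum>q\<in>P. n q) = (\<Sum>q\<in>P - {q}. n q)"
          using qP fin q by (subst sum.remove[of _ q]) (auto simp: n_def)
        also have "\<dots> \<le> (\<Sum>q\<in>P - {q}. 1)" by (rule sum_mono) (simp add: n_def)
        also have "\<dots> = s - 1"
          using qP fin card_gt_0_iff[of P] by (auto simp: s_def card_Diff_singleton of_nat_diff Suc_le_eq)
        finally have "(\<Prod>q\<in>E. n q) * ((\<Sum>q\<in>P. n q) + (1 - s)) \<le> 0"
          by (intro mult_nonneg_nonpos prod_nonneg) (auto simp: n_def)
        moreover have "F (int m) = of_real ((\<Prod>q\<in>E. n q) * ((\<Sum>q\<in>P. n q) + (1 - s)))"
          using cop by (simp add: F_def n principal_character_def)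
        ultimately show ?thesis by (simp only: Re_complex_of_real)
      qed
      moreover have "Re (F (int m)) = \<theta> * \<delta> + Re (v (int m))"
        using cop by (simp add: v(2) principal_character_def)
      ultimately have "Re (v (int m)) \<le> - (\<theta> * \<delta>)" by linarith
      then have "Re (v (int m)) / \<theta> \<le> - \<delta>" using \<theta> by (simp add: pos_divide_le_eq mult.commute)
      then show ?thesis by simp
    qed
    then show "\<forall>m. coprime p m \<and> \<not> residue_primroot p m \<longrightarrow>
        Re (of_real (1 / \<theta>) * v (int m)) \<le> - \<delta>" by blast
  qed
qed

section \<open>Intervals around fractions\<close>

text \<open>Rounding only helps: first elements of blocks of \<open>h\<close> integers inside the
  interval run from \<open>\<lfloor>\<alpha>\<rfloor> + 1\<close> to
  \<open>\<lceil>\<beta>\<rceil> - h\<close>.\<close>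

lemma card_integer_blocks_ge:
  fixes \<alpha> \<beta> :: real
  shows "finite {x::int. \<alpha> < x \<and> x + real h - 1 < \<beta>}"
    and "real (card {x::int. \<alpha> < x \<and> x + real h - 1 < \<beta>}) \<ge> \<beta> - \<alpha> - real h"
proof -
  have eq: "{x::int. \<alpha> < x \<and> x + real h - 1 < \<beta>} = {\<lfloor>\<alpha>\<rfloor> + 1..\<lceil>\<beta>\<rceil> - int h}"
  proof (rule Set.set_eqI)
    fix x :: int
    have "x + real h - 1 < \<beta> \<longleftrightarrow> x + int h - 1 < \<lceil>\<beta>\<rceil>"
      unfolding less_ceiling_iff by simp
    then show "x \<in> {x::int. \<alpha> < x \<and> x + real h - 1 < \<beta>} \<longleftrightarrow> x \<in> {\<lfloor>\<alpha>\<rfloor> + 1..\<lceil>\<beta>\<rceil> - int h}"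
      by (auto simp: floor_less_iff[symmetric])
  qed
  show "finite {x::int. \<alpha> < x \<and> x + real h - 1 < \<beta>}" unfolding eq by simp
  have "real (nat (\<lceil>\<beta>\<rceil> - int h - \<lfloor>\<alpha>\<rfloor>)) \<ge> real_of_int (\<lceil>\<beta>\<rceil> - int h - \<lfloor>\<alpha>\<rfloor>)" by simp
  also have "real_of_int (\<lceil>\<beta>\<rceil> - int h - \<lfloor>\<alpha>\<rfloor>) \<ge> \<beta> - \<alpha> - real h" by simp linarith
  finally show "real (card {x::int. \<alpha> < x \<and> x + real h - 1 < \<beta>}) \<ge> \<beta> - \<alpha> - real h"
    unfolding eq by simp
qed

lemma real_le_if_le_nat_floor:
  fixes X :: real
  assumes "0 < n" "n \<le> nat \<lfloor>X\<rfloor>"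
  shows "real n \<le> X"
proof -
  have "int n \<le> \<lfloor>X\<rfloor>" using assms by linarith
  then show ?thesis by (simp add: le_floor_iff)
qed

lemma coprime_fraction_unique:
  fixes c c' :: int and q q' :: nat
  assumes "int q' * c = int q * c'" "coprime c (int q)" "coprime c' (int q')"
  shows "q = q'"
proof -
  have "int q dvd int q' * c" using assms(1) by simp
  then have "q dvd q'" using assms(2) by (simp add: coprime_dvd_mult_left_iff coprime_commute)
  moreover have "int q' dvd int q * c'" using assms(1) by (metis dvd_triv_left)
  then have "q' dvd q" using assms(3) by (simp add: coprime_dvd_mult_left_iff coprime_commute)
  ultimately show ?thesis by (rule dvd_antisym)
qed

text \<open>Around each fraction \<open>c / q\<close> the points just above and just below \<open>p c / q\<close> are multiplied
  by \<open>q\<close> into \<open>(0, H)\<close> and \<open>(-H, 0)\<close> modulo \<open>p\<close>; for \<open>q \<le> H / h\<close> these intervals do not overlap.\<close>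

lemma burgess_intervals:
  fixes p h :: nat and H X :: real
  assumes "h > 0" "H > 0" "H < real p" "2 * H\<^sup>2 < real h * real p"
  defines "X \<equiv> H / real h"
  obtains S :: "int set" where "S \<subseteq> {0..<int p}"
    "real (card S) \<ge> 2 * real h * (\<Sum>q\<in>{1..nat \<lfloor>X\<rfloor>}. real (totient q) * (X / real q - 1))"
    "\<forall>x\<in>S. \<exists>b::int. \<forall>n<h. \<exists>m::nat. 0 < m \<and> real m < H \<and> [b * (x + int n) = int m] (mod int p)"
proof -
  define N where "N = nat \<lfloor>X\<rfloor>"
  define sg :: "bool \<Rightarrow> int" where "sg = (\<lambda>b. if b then 1 else - 1)"
  \<comment> \<open>The numerators are below \<open>q\<close> for intervals to the right of a
    fraction and at least 1 for those to the left, so that all intervals stay inside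
    \<open>(0, p)\<close>. For \<open>q = 1\<close> they are 0 and 1.\<close>
  define c :: "nat \<Rightarrow> nat \<Rightarrow> bool \<Rightarrow> int" where "c = (\<lambda>q t b. if b then int q - int t else int t)"
  \<comment> \<open>\<open>D\<close> is \<open>q\<close> times the distance from \<open>y\<close> to
    \<open>p c / q\<close>, positive on the side selected by \<open>b\<close>.\<close>
  define D :: "nat \<Rightarrow> nat \<Rightarrow> bool \<Rightarrow> int \<Rightarrow> int"
    where "D = (\<lambda>q t b y. sg b * (int q * y - int p * c q t b))"
  define J where "J = (\<lambda>(q, t, b). {x. \<forall>n<h. 0 < D q t b (x + int n) \<and> D q t b (x + int n) < H})"
  define I where "I = (SIGMA q:{1..N}. totatives q \<times> (UNIV :: bool set))"
  define S where "S = (\<Union>i\<in>I. J i)"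
  have finI: "finite I" unfolding I_def by auto
  have X: "H = X * real h" using assms by (simp add: X_def)
  have qX: "real q \<le> X" if "q \<in> {1..N}" for q
    using that by (auto simp: N_def intro: real_le_if_le_nat_floor)
  have D0: "0 < D q t b x" "D q t b x < H" if "x \<in> J (q, t, b)" for q t b x
    using that assms(1) by (auto simp: J_def dest!: spec[of _ 0])
  have range: "J (q, t, b) \<subseteq> {0..<int p}" if i: "(q, t, b) \<in> I" for q t b
  proof
    fix x assume x: "x \<in> J (q, t, b)"
    have t: "1 \<le> int t" "int t \<le> int q" and q: "int q > 0"
      using i by (auto simp: I_def in_totatives_iff)
    have "real_of_int (D q t b x) < real p" using D0[OF x] assms by linarith
    then have D: "0 < D q t b x" "D q t b x < int p" using D0[OF x] by linarith+
    have comm: "int q * int p = int p * int q" by simp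
    have "0 < int q * x \<and> int q * x < int q * int p"
    proof (cases b)
      case True
      then have eq: "D q t b x = int q * x - int p * (int q - int t)" by (simp add: D_def sg_def c_def)
      have "int p * (int q - int t) \<ge> 0" "int p * (int q - int t) \<le> int p * (int q - 1)"
        using t by (auto intro!: mult_left_mono)
      then show ?thesis using D eq comm by (simp only: right_diff_distrib) linarith
    next
      case False
      then have eq: "D q t b x = int p * int t - int q * x" by (simp add: D_def sg_def c_def)
      have "int p * int t \<ge> int p * 1" "int p * int t \<le> int p * int q"
        using t by (intro mult_left_mono; simp)+
      then show ?thesis using D eq comm by linarith
    qed
    then show "x \<in> {0..<int p}" using q by (simp add: zero_less_mult_iff)
  qed
  then have sub: "S \<subseteq> {0..<int p}" by (auto simp: S_def)
  have finJ: "finite (J i)" if "i \<in> I" for i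
    using finite_subset[OF range] that by (cases i) auto
  have card: "real (card (J (q, t, b))) \<ge> real h * (X / real q - 1)" if i: "(q, t, b) \<in> I" for q t b
  proof -
    have q: "real q > 0" using i by (auto simp: I_def)
    define \<beta> where "\<beta> = (real p * c q t b + (if b then H else 0)) / real q"
    define \<alpha> where "\<alpha> = (real p * c q t b - (if b then 0 else H)) / real q"
    have "{x::int. \<alpha> < x \<and> x + real h - 1 < \<beta>} \<subseteq> J (q, t, b)"
    proof
      fix x assume "x \<in> {x::int. \<alpha> < x \<and> x + real h - 1 < \<beta>}"
      then have x: "\<alpha> < x" "x + real h - 1 < \<beta>" by auto
      have "0 < D q t b (x + int n) \<and> D q t b (x + int n) < H" if "n < h" for n
      proof -
        have "real n \<le> real h - 1" using that by linarith
        with x have y: "\<alpha> < x + real n" "x + real n < \<beta>" by linarith+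
        define y where "y = real q * (x + real n) - real p * c q t b"
        have "- (if b then 0 else H) < y" "y < (if b then H else 0)"
          using y q by (simp_all add: \<alpha>_def \<beta>_def y_def field_simps)
        moreover have "real_of_int (D q t b (x + int n)) = sg b * y"
          by (simp add: D_def y_def)
        ultimately have "0 < real_of_int (D q t b (x + int n))" "real_of_int (D q t b (x + int n)) < H"
          by (cases b; simp add: sg_def)+
        then show ?thesis by simp
      qed
      then show "x \<in> J (q, t, b)" by (simp add: J_def)
    qed
    then have "real (card {x::int. \<alpha> < x \<and> x + real h - 1 < \<beta>}) \<le> real (card (J (q, t, b)))"
      using finJ[OF i] by (simp add: card_mono)
    moreover have "\<beta> - \<alpha> - real h \<le> real (card {x::int. \<alpha> < x \<and> x + real h - 1 < \<beta>})"
      by (rule card_integer_blocks_ge)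
    \<comment> \<open>The interval has length \<open>H / q = h * X / q\<close>.\<close>
    moreover have "\<beta> - \<alpha> - real h = real h * (X / real q - 1)"
      using q by (simp add: \<alpha>_def \<beta>_def X field_simps)
    ultimately show ?thesis by linarith
  qed
  \<comment> \<open>For a common point, \<open>q' * d - q * d'\<close> is a multiple of
    \<open>p\<close> smaller than \<open>p\<close>, hence 0. The fractions then coincide, so
    \<open>d = d'\<close>, and the sign of \<open>d\<close> determines the side.\<close>
  have disj: "J i \<inter> J i' = {}" if i: "i \<in> I" "i' \<in> I" "i \<noteq> i'" for i i'
  proof (rule ccontr)
    assume "J i \<inter> J i' \<noteq> {}"
    then obtain x where x: "x \<in> J i" "x \<in> J i'" by auto
    obtain q t b q' t' b' where [simp]: "i = (q, t, b)" "i' = (q', t', b')" by (cases i, cases i') auto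
    have cop: "coprime (c q t b) (int q)" if "(q, t, b) \<in> I" for q t b
    proof -
      have "coprime t q" using that by (auto simp: I_def in_totatives_iff)
      then have "coprime (int t) (int q)" by simp
      moreover have "gcd (int q - int t) (int q) = gcd (int t) (int q)" by (rule gcd_diff2)
      ultimately show ?thesis
        by (cases b) (simp_all only: c_def if_True if_False coprime_iff_gcd_eq_1)
    qed
    define d where "d = int q * x - int p * c q t b"
    define d' where "d' = int q' * x - int p * c q' t' b'"
    have "D q t b x = sg b * d" "D q' t' b' x = sg b' * d'"
      by (simp_all add: D_def d_def d'_def)
    then have sgd: "0 < sg b * d" "real_of_int (sg b * d) < H"
      "0 < sg b' * d'" "real_of_int (sg b' * d') < H"
      using D0[of x q t b] D0[of x q' t' b'] x by simp_all
    have "\<bar>real_of_int z\<bar> < H" if "0 < sg b * z" "real_of_int (sg b * z) < H" for b z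
      using that by (cases b) (simp_all add: sg_def)
    from this[OF sgd(1,2)] this[OF sgd(3,4)]
    have d: "\<bar>real_of_int d\<bar> < H" "\<bar>real_of_int d'\<bar> < H" .
    have q: "real q > 0" "real q' > 0" "real q \<le> X" "real q' \<le> X"
      using i qX by (auto simp: I_def)
    have "\<bar>real_of_int (int q' * d - int q * d')\<bar> \<le> real q' * \<bar>real_of_int d\<bar> + real q * \<bar>real_of_int d'\<bar>"
      by (simp add: abs_mult order_trans[OF abs_triangle_ineq4])
    also have "\<dots> < real q' * H + real q * H"
      using d q by (intro add_strict_mono mult_strict_left_mono) auto
    also have "\<dots> \<le> X * H + X * H"
      using q assms by (intro add_mono mult_right_mono) auto
    \<comment> \<open>\<open>2 * X * H\<close> equals \<open>2 * H\<^sup>2 / h\<close>, which is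
      below \<open>p\<close> by hypothesis.\<close>
    also have "\<dots> < real p"
      using assms by (simp add: X_def field_simps power2_eq_square)
    finally have "\<bar>int q' * d - int q * d'\<bar> < int p" by linarith
    moreover have "int q' * d - int q * d' = int p * (int q * c q' t' b' - int q' * c q t b)"
      by (simp add: d_def d'_def algebra_simps)
    ultimately have "int p * (int q * c q' t' b' - int q' * c q t b) = 0"
      using dvd_imp_le_int[of "int p * (int q * c q' t' b' - int q' * c q t b)" "int p"] by fastforce
    moreover have "int p \<noteq> 0" using assms by auto
    ultimately have "int q * c q' t' b' - int q' * c q t b = 0" by simp
    then have eq: "int q' * c q t b = int q * c q' t' b'" by simp
    then have qq: "q = q'"
      using i by (intro coprime_fraction_unique[OF _ cop cop]) auto
    then have cc: "c q t b = c q' t' b'" using eq q by simp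
    have "d = d'" using qq cc by (simp add: d_def d'_def)
    then have "b = b'" using sgd(1,3) by (auto simp: sg_def split: if_splits)
    moreover from this have "t = t'" using qq cc by (auto simp: c_def split: if_splits)
    ultimately show False using qq i by simp
  qed
  have "real (card S) = (\<Sum>i\<in>I. real (card (J i)))"
    unfolding S_def using finI finJ disj by (subst card_UN_disjoint) auto
  also have "\<dots> \<ge> (\<Sum>i\<in>I. real h * (X / real (fst i) - 1))"
    using card by (intro sum_mono) (metis prod.collapse)
  also have "(\<Sum>i\<in>I. real h * (X / real (fst i) - 1)) =
      (\<Sum>q\<in>{1..N}. \<Sum>j\<in>totatives q \<times> (UNIV :: bool set). real h * (X / real q - 1))"
    unfolding I_def by (subst sum.Sigma) (auto simp: case_prod_unfold)
  \<comment> \<open>The factor 2 counts the two sides, \<open>totient q\<close> the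
    numerators.\<close>
  also have "\<dots> = 2 * real h * (\<Sum>q\<in>{1..N}. real (totient q) * (X / real q - 1))"
    by (simp add: sum_distrib_left card_cartesian_product totient_def[symmetric] mult_ac)
  finally have "2 * real h * (\<Sum>q\<in>{1..N}. real (totient q) * (X / real q - 1)) \<le> real (card S)" .
  moreover have "\<exists>b::int. \<forall>n<h. \<exists>m::nat. 0 < m \<and> real m < H \<and> [b * (x + int n) = int m] (mod int p)"
    if xS: "x \<in> S" for x
  proof -
    obtain i where "x \<in> J i" using xS by (auto simp: S_def)
    then obtain q t b where "x \<in> J (q, t, b)" by (cases i) auto
    then have J: "0 < D q t b (x + int n)" "D q t b (x + int n) < H" if "n < h" for n
      using that unfolding J_def by auto
    have "0 < nat (D q t b (x + int n)) \<and> real (nat (D q t b (x + int n))) < H \<and>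
       [sg b * int q * (x + int n) = int (nat (D q t b (x + int n)))] (mod int p)" if "n < h" for n
    proof -
      \<comment> \<open>The multiplier is \<open>q\<close> up to sign; the term \<open>p * c\<close>
        disappears modulo \<open>p\<close>.\<close>
      have "[D q t b (x + int n) = sg b * int q * (x + int n)] (mod int p)"
        by (simp add: cong_iff_dvd_diff D_def algebra_simps)
      then show ?thesis using J[OF that] by (simp add: cong_sym)
    qed
    then show ?thesis by blast
  qed
  ultimately show thesis using that sub unfolding N_def by blast
qed

section \<open>Comparison of the moment bound with the interval count\<close>

lemma dirichlet_character_cong:
  assumes "dirichlet_character p chi" "[a = b] (mod int p)"
  shows "chi a = chi b"
proof -
  have shift: "chi (a + int p * int k) = chi a" for a k
  proof (induction k)
    case (Suc k)
    have "chi (a + int p * int (Suc k)) = chi ((a + int p * int k) + int p)"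
      by (simp add: algebra_simps)
    also have "\<dots> = chi a" using assms(1) Suc.IH by (simp only: dirichlet_character_def)
    finally show ?case .
  qed simp
  obtain k where k: "b = a + int p * k" using assms(2) by (metis cong_iff_lin)
  show ?thesis
  proof (cases "k \<ge> 0")
    case True
    then show ?thesis using shift[of a "nat k"] k by simp
  next
    case False
    then show ?thesis using shift[of b "nat (- k)"] k by simp
  qed
qed

lemma character_comb_cong:
  assumes "character_comb p Q w u" "[a = b] (mod int p)"
  shows "u a = u b"
  using assms(1)
  by (induction rule: character_comb.induct)
     (use assms(2) dirichlet_character_cong in \<open>auto simp: nonprincipal_of_order_dvd_def\<close>)

text \<open>Along a block starting in \<open>S\<close>, multiplication by \<open>b\<close> lands on
  non-roots, so every real part of \<open>u\<close> is at most \<open>- \<delta>\<close> and the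
  block sum has modulus at least \<open>h * \<delta>\<close>. Comparing \<open>k\<close>-th powers
  with the moment bound limits \<open>card S\<close>, which \<open>burgess_intervals\<close> bounds
  from below.\<close>

lemma primroot_free_intervals_bound:
  fixes p e r h :: nat and H X W :: real
  assumes "prime p" "odd p" "h > 0" "r > 0" "H > 0" "H < real p" "2 * H\<^sup>2 < real h * real p"
  defines "X \<equiv> H / real h"
  defines "P \<equiv> {q. prime q \<and> q dvd p - 1 \<and> \<not> q dvd e}"
  defines "E \<equiv> {q. prime q \<and> q dvd p - 1 \<and> q dvd e}"
  defines "\<delta> \<equiv> 1 - (\<Sum>q\<in>P. 1 / real q)"
  assumes "\<delta> > 0"
    and W: "\<And>chi. dirichlet_character p chi \<Longrightarrow> chi \<noteq> principal_character p \<Longrightarrow>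
      (\<Sum>x\<in>{0..<int p}. cmod (\<Sum>n<h. chi (x + int n)) ^ (2 * r)) \<le> W * sqrt (real p) * real h ^ (2 * r)"
    and no_primroot: "\<And>m. 0 < m \<Longrightarrow> real m < H \<Longrightarrow> \<not> residue_primroot p m"
  shows "2 * real h * (\<Sum>q\<in>{1..nat \<lfloor>X\<rfloor>}. real (totient q) * (X / real q - 1)) \<le>
    ((2 + (real (card P) - 1) / \<delta>) * 2 ^ card E) ^ (2 * r) * (W * sqrt (real p))"
proof -
  define k where "k = 2 * r"
  have k: "even k" "k > 0" using assms by (auto simp: k_def)
  define K where "K = W * sqrt (real p) * real h ^ k"
  have W': "(\<Sum>x\<in>{0..<int p}. cmod (\<Sum>n<h. chi (x + int n)) ^ k) \<le> K"
    if "dirichlet_character p chi" "chi \<noteq> principal_character p" for chi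
    using W[OF that] by (simp add: k_def K_def)
  have K0: "K \<ge> 0" by (rule character_sum_bound_nonneg[OF assms(1,2) k(1) W'])
  define C where "C = (2 + (real (card P) - 1) / \<delta>) * 2 ^ card E"
  obtain Q u where Q: "Q > 0"
    and u: "character_comb p Q ((2 * \<delta> + real (card P) - 1) * 2 ^ card E - \<delta>) u"
    and neg: "\<And>m. coprime p m \<Longrightarrow> \<not> residue_primroot p m \<Longrightarrow> Re (u (int m)) \<le> - \<delta>"
    by (rule primitive_root_sieve[OF assms(1), of e, folded P_def E_def, folded \<delta>_def, OF \<open>\<delta> > 0\<close>]) blast
  have w: "(2 * \<delta> + real (card P) - 1) * 2 ^ card E - \<delta> = \<delta> * (C - 1)"
  proof -
    have "\<delta> * (2 + (real (card P) - 1) / \<delta>) = 2 * \<delta> + real (card P) - 1"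
      using \<open>\<delta> > 0\<close> by (simp add: distrib_left)
    then have "\<delta> * C = (2 * \<delta> + real (card P) - 1) * 2 ^ card E"
      unfolding C_def mult.assoc[symmetric] by (rule arg_cong)
    then show ?thesis by (simp add: right_diff_distrib)
  qed
  have C1: "\<delta> * (C - 1) \<ge> 0" using character_comb_nonneg[OF u] unfolding w .
  obtain G where G: "\<And>x b. cmod (\<Sum>n<h. u (b * (x + int n))) \<le> G x"
    and G_sum: "(\<Sum>x\<in>{0..<int p}. G x ^ k) \<le> (\<delta> * (C - 1)) ^ k * K"
    by (rule character_comb_power_mean[OF u Q k W', unfolded w]) blast+
  obtain S :: "int set" where S: "S \<subseteq> {0..<int p}"
    and card_S: "real (card S) \<ge> 2 * real h * (\<Sum>q\<in>{1..nat \<lfloor>X\<rfloor>}. real (totient q) * (X / real q - 1))"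
    and S_int: "\<And>x. x \<in> S \<Longrightarrow> \<exists>b::int. \<forall>n<h. \<exists>m::nat. 0 < m \<and> real m < H \<and> [b * (x + int n) = int m] (mod int p)"
    by (rule burgess_intervals[OF \<open>h > 0\<close> \<open>H > 0\<close> \<open>H < real p\<close> assms(7), folded X_def]) blast
  have G0: "G x \<ge> 0" for x using G[of 0 x] norm_ge_zero order_trans by blast
  have G_S: "real h * \<delta> \<le> G x" if xS: "x \<in> S" for x
  proof -
    obtain b :: int and m :: "nat \<Rightarrow> nat" where b: "\<And>n. n < h \<Longrightarrow> 0 < m n"
      "\<And>n. n < h \<Longrightarrow> real (m n) < H" "\<And>n. n < h \<Longrightarrow> [b * (x + int n) = int (m n)] (mod int p)"
      using S_int[OF xS] by metis
    have "Re (u (b * (x + int n))) \<le> - \<delta>" if "n < h" for n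
    proof -
      \<comment> \<open>Since \<open>0 < m n < p\<close>, the residue is a unit, as the sieve
        requires.\<close>
      have "m n < p" using b(2)[OF that] assms by linarith
      then have "\<not> p dvd m n" using b(1)[OF that] by (auto dest: dvd_imp_le)
      then have "coprime p (m n)" using assms(1) by (simp add: prime_imp_coprime)
      then show ?thesis
        using neg no_primroot b(1,2) that character_comb_cong[OF u b(3)[OF that]] by simp
    qed
    then have "(\<Sum>n<h. Re (u (b * (x + int n)))) \<le> (\<Sum>n<h. - \<delta>)"
      by (intro sum_mono) auto
    then have "real h * \<delta> \<le> - Re (\<Sum>n<h. u (b * (x + int n)))" by simp
    also have "\<dots> \<le> cmod (\<Sum>n<h. u (b * (x + int n)))"
      using abs_Re_le_cmod[of "\<Sum>n<h. u (b * (x + int n))"] by linarith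
    also have "\<dots> \<le> G x" by (rule G)
    finally show ?thesis .
  qed
  have "real (card S) * (real h * \<delta>) ^ k = (\<Sum>x\<in>S. (real h * \<delta>) ^ k)" by simp
  also have "\<dots> \<le> (\<Sum>x\<in>S. G x ^ k)"
    using G_S \<open>\<delta> > 0\<close> by (intro sum_mono power_mono) auto
  also have "\<dots> \<le> (\<Sum>x\<in>{0..<int p}. G x ^ k)"
    using S G0 by (intro sum_mono2) auto
  also have "\<dots> \<le> (\<delta> * (C - 1)) ^ k * K" by (rule G_sum)
  \<comment> \<open>Relaxing \<open>C - 1\<close> to \<open>C\<close> gives the constant of the
    theorem; it needs \<open>K \<ge> 0\<close>.\<close>
  also have "\<dots> \<le> (\<delta> * C) ^ k * K"
    using C1 \<open>\<delta> > 0\<close> K0 by (intro mult_right_mono power_mono mult_left_mono) auto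
  also have "\<dots> = (C ^ k * (W * sqrt (real p))) * (real h * \<delta>) ^ k"
    by (simp add: K_def power_mult_distrib)
  finally have "real (card S) \<le> C ^ k * (W * sqrt (real p))"
    using \<open>\<delta> > 0\<close> \<open>h > 0\<close> by simp
  then show ?thesis using card_S unfolding C_def k_def by linarith
qed

text \<open>The hypotheses allow \<open>A < 0\<close>, but then \<open>X < 2 pi\<^sup>2 / 9\<close>, and \<open>T \<ge> 1\<close> already suffices.\<close>

lemma burgess_constants_bound:
  fixes X T B A :: real and k :: nat
  defines "A \<equiv> 1 - 2 * pi\<^sup>2 / (9 * X)"
  assumes "X \<ge> 2" "A \<noteq> 0" "B \<ge> 1" "even k" "k > 0"
    and T: "T \<ge> 1" "T \<ge> 3 / pi\<^sup>2 * X\<^sup>2 - 5 / 8 * X"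
  shows "pi\<^sup>2 / 6 * (B ^ (k - 1) / A ^ k) * (2 * T) \<ge> X\<^sup>2"
proof -
  have pi2: "9 \<le> pi\<^sup>2" "pi\<^sup>2 \<le> 16"
    using power_mono[of 3 pi 2] power_mono[of pi 4 2] pi_gt3 pi_less_4 by auto
  define c where "c = 2 * pi\<^sup>2 / 9"
  have c: "2 \<le> c" "c \<le> 32 / 9" using pi2 by (simp_all add: c_def)
  have A: "A = 1 - c / X" by (simp add: A_def c_def)
  \<comment> \<open>As \<open>X \<ge> 2\<close>, \<open>A\<close> lies between
    \<open>- 7 / 9\<close> and 1, so the even power \<open>k\<close> may be lowered to 2.\<close>
  have "c / X \<le> 32 / 9 / 2" using c assms by (intro frac_le) auto
  moreover have "c / X \<ge> 0" using c assms by simp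
  ultimately have A1: "\<bar>A\<bar> \<le> 1" unfolding A by linarith
  have Ak: "A ^ k > 0" using assms by (simp add: zero_less_power_eq)
  have "\<bar>A\<bar> ^ k \<le> \<bar>A\<bar> ^ 2"
    using assms A1 by (intro power_decreasing) (auto elim!: evenE)
  then have AA: "A ^ k \<le> A\<^sup>2" using assms by (simp add: power_even_abs)
  have "X * A = X - c" using \<open>X \<ge> 2\<close> by (simp add: A right_diff_distrib)
  then have XA: "X\<^sup>2 * A\<^sup>2 = (X - c)\<^sup>2" by (simp flip: power_mult_distrib)
  have "X\<^sup>2 * A\<^sup>2 \<le> pi\<^sup>2 / 3 * T"
  proof (cases "A > 0")
    case True
    then have "A\<^sup>2 \<le> A" using A1 by (simp add: power2_eq_square mult_left_le)
    then have "X\<^sup>2 * A\<^sup>2 \<le> X\<^sup>2 * A" by (rule mult_left_mono) auto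
    \<comment> \<open>In these units \<open>2 * pi\<^sup>2 / 9\<close> becomes the coefficient
      \<open>2 / 3\<close>, which exceeds the \<open>5 / 8\<close> of the totient estimate.\<close>
    also have "\<dots> = pi\<^sup>2 / 3 * (3 / pi\<^sup>2 * X\<^sup>2 - 2 / 3 * X)"
      using assms by (simp add: A_def field_simps power2_eq_square)
    also have "\<dots> \<le> pi\<^sup>2 / 3 * T" using T assms by (intro mult_left_mono) auto
    finally show ?thesis .
  next
    case False
    then have "c / X \<ge> 1" using A by simp
    then have "X \<le> c" using assms by (simp add: field_simps)
    \<comment> \<open>\<open>X\<close> lies between 2 and \<open>c \<le> 32 / 9\<close>; the square
      of \<open>14 / 9\<close> is below 3, and \<open>3 \<le> pi\<^sup>2 / 3\<close>.\<close>
    then have "\<bar>X - c\<bar> \<le> 14 / 9" using c assms by linarith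
    then have "(X - c)\<^sup>2 \<le> (14 / 9)\<^sup>2" by (metis abs_ge_zero power2_abs power_mono)
    also have "\<dots> \<le> 3 * 1" by (simp add: power2_eq_square)
    also have "\<dots> \<le> pi\<^sup>2 / 3 * T" using pi2 T by (intro mult_mono) auto
    finally show ?thesis unfolding XA .
  qed
  then have "X\<^sup>2 * A ^ k \<le> pi\<^sup>2 / 3 * T"
    using AA by (meson mult_left_mono order_trans zero_le_power2)
  also have "\<dots> \<le> B ^ (k - 1) * (pi\<^sup>2 / 3 * T)"
    using mult_right_mono[OF one_le_power[OF \<open>B \<ge> 1\<close>], of "pi\<^sup>2 / 3 * T" "k - 1"] T by simp
  finally have "X\<^sup>2 \<le> B ^ (k - 1) * (pi\<^sup>2 / 3 * T) / A ^ k"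
    using Ak by (simp add: pos_le_divide_eq)
  then show ?thesis by (simp add: mult_ac)
qed

theorem theorem3:
  fixes p e r h s :: nat and P :: "nat set" and \<omega> :: nat
    and H X \<delta> W :: real and A B :: "real \<Rightarrow> real"
  assumes "prime p" and "odd p"
    and "even e" and "e dvd p - 1"
  defines "P \<equiv> {q. prime q \<and> q dvd p - 1 \<and> \<not> q dvd e}"
  defines "s \<equiv> card P"
  defines "\<omega> \<equiv> card {q. prime q \<and> q dvd p - 1}"
  defines "\<delta> \<equiv> 1 - (\<Sum>q\<in>P. 1 / real q)"
  assumes "\<delta> > 0"
    and "r > 0" and "h \<ge> 2" and "H > 0"
    and "H \<ge> 2 * real h" and "2 * H ^ 2 < real h * real p"
  defines "X \<equiv> H / real h"
  assumes W: "\<And>chi. dirichlet_character p chi \<Longrightarrow> chi \<noteq> principal_character p \<Longrightarrow>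
      (\<Sum>x\<in>{0..<int p}. cmod (\<Sum>n<h. chi (x + int n)) ^ (2 * r))
        \<le> W * sqrt (real p) * real h ^ (2 * r)"
  defines "A \<equiv> \<lambda>X. 1 - 2 * pi ^ 2 / (9 * X)"
  defines "B \<equiv> \<lambda>X. 1 + 2 * pi ^ 2 / (9 * X) + 1 / real h + pi ^ 2 / (3 * real h) * (ln X / X)"
  assumes "A X \<noteq> 0"  (* the quotient below is defined; in HOL it would be 0 otherwise *)
    and "pi ^ 2 / 6 * (B X ^ (2 * r - 1) / A X ^ (2 * r))
        * ((2 + (real s - 1) / \<delta>) * 2 ^ (\<omega> - s)) ^ (2 * r)
        * real h * sqrt (real p) * W < H ^ 2"
  shows "real (least_primroot p) < H"
proof (rule ccontr)
  assume contr: "\<not> real (least_primroot p) < H"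
  have no_primroot: "\<not> residue_primroot p m" if "0 < m" "real m < H" for m
  proof -
    have "m < least_primroot p" using that contr by linarith
    then show ?thesis using that not_less_Least unfolding least_primroot_def by blast
  qed
  have h: "real h > 0" "h > 0" using \<open>h \<ge> 2\<close> by auto
  have H: "H = X * real h" using h by (simp add: X_def)
  have X2: "X \<ge> 2" using \<open>H \<ge> 2 * real h\<close> h by (simp add: X_def field_simps)
  \<comment> \<open>Multiplying \<open>2 * h \<le> H\<close> by \<open>2 * H\<close> gives
    \<open>4 * h * H \<le> 2 * H\<^sup>2 < h * p\<close>.\<close>
  have "H < real p"
  proof -
    have "real h * (4 * H) \<le> 2 * H * H"
      using \<open>H \<ge> 2 * real h\<close> \<open>H > 0\<close> mult_right_mono[of "2 * real h" H "2 * H"] by simp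
    also have "\<dots> < real h * real p" using \<open>2 * H ^ 2 < real h * real p\<close> by (simp add: power2_eq_square)
    finally have "4 * H < real p" using h by simp
    then show ?thesis using \<open>H > 0\<close> by linarith
  qed
  define E where "E = {q. prime q \<and> q dvd p - 1 \<and> q dvd e}"
  have "\<omega> - s = card E"
  proof -
    have "p - 1 > 0" using \<open>prime p\<close> prime_gt_1_nat by auto
    then have fin: "finite {q. prime q \<and> q dvd p - 1}"
      by (auto intro: finite_subset[of _ "{..p - 1}"] dest: dvd_imp_le)
    then have "finite P" "finite E" unfolding P_def E_def by (auto elim: finite_subset[rotated])
    moreover have "{q. prime q \<and> q dvd p - 1} = P \<union> E" "P \<inter> E = {}"
      by (auto simp: P_def E_def)
    ultimately show ?thesis by (simp add: \<omega>_def s_def card_Un_disjoint)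
  qed
  define T where "T = (\<Sum>q\<in>{1..nat \<lfloor>X\<rfloor>}. real (totient q) * (X / real q - 1))"
  define C where "C = ((2 + (real s - 1) / \<delta>) * 2 ^ (\<omega> - s)) ^ (2 * r) * (W * sqrt (real p))"
  have TC: "2 * real h * T \<le> C"
    unfolding T_def C_def \<open>\<omega> - s = card E\<close> unfolding X_def s_def E_def P_def \<delta>_def
    by (rule primroot_free_intervals_bound[OF \<open>prime p\<close> \<open>odd p\<close> h(2) \<open>r > 0\<close> \<open>H > 0\<close> \<open>H < real p\<close>
          \<open>2 * H ^ 2 < real h * real p\<close> \<open>\<delta> > 0\<close>[unfolded \<delta>_def P_def] W no_primroot])
  have nonneg: "real (totient q) * (X / real q - 1) \<ge> 0" if "q \<in> {1..nat \<lfloor>X\<rfloor>}" for q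
    using that real_le_if_le_nat_floor[of q X] by auto
  \<comment> \<open>The term \<open>q = 1\<close> alone is \<open>X - 1 \<ge> 1\<close>, and the
    others are nonnegative.\<close>
  have "T \<ge> (\<Sum>q\<in>{1}. real (totient q) * (X / real q - 1))"
    unfolding T_def using X2 nonneg by (intro sum_mono2) (auto simp: le_nat_iff le_floor_iff)
  then have T1: "T \<ge> 1" using X2 by simp
  have T2: "T \<ge> 3 / pi\<^sup>2 * X\<^sup>2 - 5 / 8 * X"
    unfolding T_def using X2 by (intro sum_totient_weighted_ge) simp
  have "B X \<ge> 1" using X2 h unfolding B_def by simp
  have B0: "0 \<le> B X ^ (2 * r - 1) / A X ^ (2 * r)"
    using \<open>B X \<ge> 1\<close> by (simp add: zero_le_even_power)
  \<comment> \<open>The left side is \<open>H\<^sup>2\<close>. Replacing \<open>2 * h * T\<close> by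
    its upper bound \<open>C\<close> turns the right side into the quantity assumed to be below
    \<open>H\<^sup>2\<close>.\<close>
  have "X\<^sup>2 * (real h)\<^sup>2 \<le> pi\<^sup>2 / 6 * (B X ^ (2 * r - 1) / A X ^ (2 * r)) * (2 * T) * (real h)\<^sup>2"
    using burgess_constants_bound[OF X2 _ \<open>B X \<ge> 1\<close> _ _ T1 T2, of "2 * r"] \<open>A X \<noteq> 0\<close> \<open>r > 0\<close>
    unfolding A_def by (intro mult_right_mono) auto
  also have "\<dots> = pi\<^sup>2 / 6 * (B X ^ (2 * r - 1) / A X ^ (2 * r)) * real h * (2 * real h * T)"
    by (simp add: power2_eq_square)
  also have "\<dots> \<le> pi\<^sup>2 / 6 * (B X ^ (2 * r - 1) / A X ^ (2 * r)) * real h * C"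
    using TC B0 h by (intro mult_left_mono mult_nonneg_nonneg) auto
  also have "\<dots> = pi ^ 2 / 6 * (B X ^ (2 * r - 1) / A X ^ (2 * r))
        * ((2 + (real s - 1) / \<delta>) * 2 ^ (\<omega> - s)) ^ (2 * r) * real h * sqrt (real p) * W"
    by (simp add: C_def mult_ac)
  also have "\<dots> < H ^ 2" by fact
  finally show False by (simp add: H power_mult_distrib)
qed

end
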